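(* Let $(S(t))_{t\ge0}$ and $(T(t))_{t\ge0}$ be two convex monotone semigroups on $C_\kappa$ and let $\mathcal D\subset\mathcal L_T\cap\mathcal L_S^+$. Denote by $A_\Gamma^+$ the upper $\Gamma$-generator of $(S(t))_{t\ge0}$ and by $B$ and $B_\Gamma^+$ the generator and the upper $\Gamma$-generator of $(T(t))_{t\ge0}$, respectively. Assume that $T(t)\colon\mathcal D\to\mathcal D$ for all $t\ge0$ and $$A_\Gamma^+f\le B_\Gamma^+f\quad\text{for all }f\in\mathcal D.$$ Then $S(t)f\le T(t)f$ for all $t\ge0$ and $f\in\mathcal D\cap D(B)$.
   Context: $(X,d)$ is a complete separable metric space and $\kappa\colon X\to(0,\infty)$ is bounded and continuous. Functions are ordered pointwise, $f^+=\max\{f,0\}$, and $\|f\|_\kappa:=\sup_{x\in X}|f(x)|\kappa(x)\in[0,\infty]$. $C_\kappa$ is the space of continuous $f\colon X\to\mathbb R$ with $\|f\|_\kappa<\infty$; $U_\kappa$ is the set of upper semicontinuous $f\colon X\to[-\infty,\infty)$ with $\|f^+\|_\kappa<\infty$. A set $F\subset U_\kappa$ is bounded above if $\sup_{f\in F}\|f^+\|_\kappa<\infty$. Convergence $f_n\to f$ in $C_\kappa$ (mixed topology) means $\sup_n\|f_n\|_\kappa<\infty$ and $\sup_{x\in K}|f_n(x)-f(x)|\to0$ for every compact $K\subset X$; limits as $h\downarrow0$ are along all sequences $h_n>0$, $h_n\to0$. $\Gamma$-limits: for $(f_n)\subset U_\kappa$ bounded above, $(\Gamma\text{-}\limsup_{n\to\infty}f_n)(x):=\sup\{\limsup_n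 f_n(x_n): x_n\to x\}$. For families, $\Gamma\text{-}\limsup_{s\to t}f_s$ is the pointwise supremum of $\Gamma\text{-}\limsup_n f_{s_n}$ over all sequences $0\le s_n\to t$; $\Gamma\text{-}\limsup_{h\downarrow 0}$ is the same with sequences $h_n>0$, $h_n\to0$. A convex monotone semigroup on $C_\kappa$ is a family of operators $S(t)\colon C_\kappa\to C_\kappa$, $t\ge0$, such that: (S1) each $S(t)$ is convex and monotone, and $S(t)f_n\downarrow0$ pointwise whenever $(f_n)\subset C_\kappa$ decreases pointwise to $0$; (S2) $S(0)f=f$ and $S(s+t)f=S(s)S(t)f$; (S3) $\sup_{t\in[0,T]}\|S(t)\frac r\kappa\|_\kappa<\infty$ for all $r,T\ge0$; (S4) $\Gamma\text{-}\limsup_{s\to t}S(s)f\le S(t)f$ for all $t\ge0$, $f\in C_\kappa$. For a semigroup $(S(t))$: the Lipschitz set $\mathcal L_S$ is the set of $f\in C_\kappa$ with $\limsup_{h\downarrow0}\|\frac{S(h)f-f}{h}\|_\kappa<\infty$; the upper Lipschitz set $\mathcal L_S^+$ is the set of $f\in C_\kappa$ with $\limsup_{h\downarrow0}\|\frac{(S(h)f-f)^+}{h}\|_\kappa<\infty$. The generator is $Af:=\lim_{h\downarrow0}\frac{S(h)f-f}{h}\in C_\kappa$ (mixed topology) with domain $D(A)$ all $f\in C_\kappa$ for which this limit exists. The upper $\Gamma$-generator is $A_\Gamma^+\colon\mathcal L_S^+\to U_\kappa$, $A_\Gamma^+f:=\Gamma\text{-}\limsup_{h\downarrow0}\frac{S(h)f-f}{h}$.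 The same notions are used for $(T(t))$. *)

theory Defs
  imports "HOL-Analysis.Analysis"
begin

text \<open>
  Functions \<open>X \<rightarrow> \<real>\<close> have type \<open>'a \<Rightarrow> real\<close>; the order \<open>\<le>\<close> on
  functions is the pointwise one.  Functions with values in \<open>[-\<infinity>, \<infinity>)\<close> have type \<open>'a \<Rightarrow> ereal\<close>.
\<close>

definition wnorm :: "('a \<Rightarrow> real) \<Rightarrow> ('a \<Rightarrow> real) \<Rightarrow> ereal" where
  "wnorm \<kappa> f = (SUP x. ereal (\<bar>f x\<bar> * \<kappa> x))"

definition C_kappa :: "('a::topological_space \<Rightarrow> real) \<Rightarrow> ('a \<Rightarrow> real) set" where
  "C_kappa \<kappa> = {f. continuous_on UNIV f \<and> wnorm \<kappa> f < \<infinity>}"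

definition mixed_converges ::
  "('a::metric_space \<Rightarrow> real) \<Rightarrow> (nat \<Rightarrow> 'a \<Rightarrow> real) \<Rightarrow> ('a \<Rightarrow> real) \<Rightarrow> bool" where
  "mixed_converges \<kappa> f g \<longleftrightarrow>
     (SUP n. wnorm \<kappa> (f n)) < \<infinity> \<and> (\<forall>K. compact K \<longrightarrow> uniform_limit K f g sequentially)"

text \<open>
  The \<open>\<Gamma>\<close>-limit superior is defined here for arbitrary extended real-valued functions.  It
  is only used for sequences of continuous functions that are bounded above in the weighted norm.
\<close>

definition Gamma_limsup :: "(nat \<Rightarrow> 'a::metric_space \<Rightarrow> ereal) \<Rightarrow> 'a \<Rightarrow> ereal" where
  "Gamma_limsup f x = Sup {limsup (\<lambda>n. f n (xs n)) | xs. xs \<longlonglongrightarrow> x}"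

text \<open>
  The index set \<open>I\<close> is \<open>{0..}\<close> for the limit superior as \<open>s \<rightarrow> t\<close> (where \<open>s n = t\<close> is
  allowed), and \<open>{0<..}\<close> with \<open>t = 0\<close> for the limit superior as \<open>h \<down> 0\<close>.
\<close>

definition Gamma_limsup_within ::
  "real set \<Rightarrow> real \<Rightarrow> (real \<Rightarrow> 'a::metric_space \<Rightarrow> ereal) \<Rightarrow> 'a \<Rightarrow> ereal" where
  "Gamma_limsup_within I t f x =
     Sup {Gamma_limsup (\<lambda>n. f (s n)) x | s. (\<forall>n. s n \<in> I) \<and> s \<longlonglongrightarrow> t}"

definition decreases_to_0 :: "(nat \<Rightarrow> 'a \<Rightarrow> real) \<Rightarrow> bool" where
  "decreases_to_0 f \<longleftrightarrow> decseq f \<and> (\<forall>x. (\<lambda>n. f n x) \<longlonglongrightarrow> 0)"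

text \<open>Only the values \<open>S t f\<close> for \<open>t \<ge> 0\<close> and \<open>f \<in> C_kappa \<kappa>\<close> are meaningful.\<close>

locale convex_monotone_semigroup =
  fixes \<kappa> :: "'a::polish_space \<Rightarrow> real"
    and S :: "real \<Rightarrow> ('a \<Rightarrow> real) \<Rightarrow> ('a \<Rightarrow> real)"
  assumes maps_to: "\<And>t f. t \<ge> 0 \<Longrightarrow> f \<in> C_kappa \<kappa> \<Longrightarrow> S t f \<in> C_kappa \<kappa>"
    and convex: "\<And>t f g c x. t \<ge> 0 \<Longrightarrow> f \<in> C_kappa \<kappa> \<Longrightarrow> g \<in> C_kappa \<kappa> \<Longrightarrow> 0 \<le> c \<Longrightarrow> c \<le> 1 \<Longrightarrow>
      S t (\<lambda>y. c * f y + (1 - c) * g y) x \<le> c * S t f x + (1 - c) * S t g x"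
    and monotone: "\<And>t f g. t \<ge> 0 \<Longrightarrow> f \<in> C_kappa \<kappa> \<Longrightarrow> g \<in> C_kappa \<kappa> \<Longrightarrow> f \<le> g \<Longrightarrow> S t f \<le> S t g"
    and continuous_from_above: "\<And>t f. t \<ge> 0 \<Longrightarrow> (\<And>n. f n \<in> C_kappa \<kappa>) \<Longrightarrow> decreases_to_0 f \<Longrightarrow>
      decreases_to_0 (\<lambda>n. S t (f n))"
    and at_0: "\<And>f. f \<in> C_kappa \<kappa> \<Longrightarrow> S 0 f = f"
    and semigroup: "\<And>s t f. s \<ge> 0 \<Longrightarrow> t \<ge> 0 \<Longrightarrow> f \<in> C_kappa \<kappa> \<Longrightarrow> S (s + t) f = S s (S t f)"
    and locally_bounded: "\<And>r T. r \<ge> 0 \<Longrightarrow> T \<ge> 0 \<Longrightarrow>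
      (SUP t\<in>{0..T}. wnorm \<kappa> (S t (\<lambda>x. r / \<kappa> x))) < \<infinity>"
    and Gamma_usc: "\<And>t f. t \<ge> 0 \<Longrightarrow> f \<in> C_kappa \<kappa> \<Longrightarrow>
      Gamma_limsup_within {0..} t (\<lambda>s x. ereal (S s f x)) \<le> (\<lambda>x. ereal (S t f x))"

definition lipschitz_set ::
  "('a::topological_space \<Rightarrow> real) \<Rightarrow> (real \<Rightarrow> ('a \<Rightarrow> real) \<Rightarrow> 'a \<Rightarrow> real) \<Rightarrow> ('a \<Rightarrow> real) set" where
  "lipschitz_set \<kappa> S = {f \<in> C_kappa \<kappa>.
     Limsup (at_right 0) (\<lambda>h. wnorm \<kappa> (\<lambda>x. (S h f x - f x) / h)) < \<infinity>}"

definition upper_lipschitz_set ::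
  "('a::topological_space \<Rightarrow> real) \<Rightarrow> (real \<Rightarrow> ('a \<Rightarrow> real) \<Rightarrow> 'a \<Rightarrow> real) \<Rightarrow> ('a \<Rightarrow> real) set" where
  "upper_lipschitz_set \<kappa> S = {f \<in> C_kappa \<kappa>.
     Limsup (at_right 0) (\<lambda>h. wnorm \<kappa> (\<lambda>x. max (S h f x - f x) 0 / h)) < \<infinity>}"

text \<open>
  The generator is an operator with a domain and is represented by its graph, so that its
  domain is \<open>Domain (generator \<kappa> S)\<close>.
\<close>

definition generator ::
  "('a::metric_space \<Rightarrow> real) \<Rightarrow> (real \<Rightarrow> ('a \<Rightarrow> real) \<Rightarrow> 'a \<Rightarrow> real) \<Rightarrow> ('a \<Rightarrow> real) rel" where
  "generator \<kappa> S = {(f, g). f \<in> C_kappa \<kappa> \<and> g \<in> C_kappa \<kappa> \<and>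
     (\<forall>h. (\<forall>n. h n > 0) \<and> h \<longlonglongrightarrow> 0 \<longrightarrow>
        mixed_converges \<kappa> (\<lambda>n x. (S (h n) f x - f x) / h n) g)}"

text \<open>Meaningful for \<open>f \<in> upper_lipschitz_set \<kappa> S\<close>.\<close>

definition upper_Gamma_generator ::
  "(real \<Rightarrow> ('a::metric_space \<Rightarrow> real) \<Rightarrow> 'a \<Rightarrow> real) \<Rightarrow> ('a \<Rightarrow> real) \<Rightarrow> 'a \<Rightarrow> ereal" where
  "upper_Gamma_generator S f =
     Gamma_limsup_within {0<..} 0 (\<lambda>h x. ereal ((S h f x - f x) / h))"

end

theory Submission
  imports Defs
begin

text \<open>
  Write \<open>g = T s f\<close> for a point of the orbit of \<open>f \<in> D \<inter> D(B)\<close> and \<open>b = B f\<close>.  One would like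
  to show that \<open>s \<mapsto> S (t - s) (T s f) x\<close> is nondecreasing by comparing \<open>S h g\<close> with \<open>T h g\<close>
  for small \<open>h\<close>.  The difficulty is that \<open>g\<close> need not belong to the domain of \<open>B\<close>: the generator
  domain is not invariant under a nonlinear semigroup.

  What replaces the generator at \<open>g\<close> are the difference quotients
  \<open>w \<epsilon> = (T s (f + \<epsilon> b) - T s f) / \<epsilon>\<close>.  They are continuous and, by convexity, decrease as
  \<open>\<epsilon> \<down> 0\<close>; since \<open>T h g = T s (T h f)\<close> and \<open>T h f = f + h b + o(h)\<close>, every \<open>w \<epsilon>\<close> lies
  above the upper \<open>\<Gamma>\<close>-generator of \<open>T\<close> at \<open>g\<close> (\<open>upper_Gamma_generator_orbit_le\<close>) and hence, by
  hypothesis, above that of \<open>S\<close>.  So \<open>S h g \<le> g + h (w \<epsilon> + o(1))\<close>, where the error term has a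
  majorant in \<open>C_kappa\<close> that decreases to \<open>0\<close> (\<open>infinitesimal_majorant\<close>).  Now fix \<open>r\<close> and let
  \<open>R = S r \<circ> T s\<close>, again a convex monotone operator.  Applying \<open>S r\<close> bounds
  \<open>(S r (S h g) - S r g) / h\<close> by \<open>Q \<epsilon> + o(1)\<close> with \<open>Q \<epsilon> = (R (f + \<epsilon> b) - R f) / \<epsilon>\<close>, whereas
  \<open>(S r (T h g) - S r g) / h = (R (T h f) - R f) / h \<ge> Q h - o(1)\<close>.  Both \<open>Q \<epsilon>\<close> and \<open>Q h\<close> tend
  to the directional derivative of \<open>R\<close> at \<open>f\<close> along \<open>b\<close>, so for every fixed \<open>r\<close> the limit superior of
  \<open>(S r (S h g) x - S r (T h g) x) / h\<close> is at most \<open>0\<close> (\<open>infinitesimal_comparison\<close>).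

  On the diagonal, however, \<open>r = t - s - h\<close> moves with \<open>h\<close>, and the limit need not be uniform in \<open>r\<close>.
  Averaging removes this problem: for a window length \<open>\<eta>\<close> let
  \<open>I \<tau>\<close> be the integral of \<open>S r (T \<tau> f) x\<close> over \<open>r \<in> [t - \<tau> - \<eta>, t - \<tau>]\<close>.  After a translation,
  \<open>I \<tau> - I (\<tau> + h)\<close> is an integral of \<open>S r (S h g) x - S r (T h g) x\<close>, and the statement for
  fixed \<open>r\<close> together with dominated convergence shows that \<open>I \<tau> \<le> I (\<tau> + h) + \<epsilon> h\<close> for every
  \<open>\<epsilon> > 0\<close> and suitable small \<open>h > 0\<close>.  The domination uses that \<open>D\<close> is invariant and consists of points that are Lipschitz
  for \<open>T\<close> and upper Lipschitz for \<open>S\<close>.  As \<open>I\<close> is upper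
  semicontinuous from the left, \<open>I 0 \<le> I (t - \<eta>)\<close> follows, and letting \<open>\<eta> \<down> 0\<close> gives the claim.
\<close>

section \<open>Decreasing continuous majorants\<close>

text \<open>
  The filter \<open>sequentially \<times>\<^sub>F nhds y\<close> expresses what \<open>\<Gamma>\<close>-limits see: index and point move
  simultaneously.  The criterion involves index sequences \<open>m\<close> because a failure of the conclusion
  only yields bad indices \<open>m k \<ge> k\<close>, one for each \<open>k\<close>.
\<close>

lemma eventually_sequentially_nhdsI:
  fixes y :: "'a::metric_space"
  assumes "\<And>m z. (\<And>k. k \<le> m k) \<Longrightarrow> z \<longlonglongrightarrow> y \<Longrightarrow> \<exists>k. P (m k) (z k)"
  shows "\<forall>\<^sub>F p in sequentially \<times>\<^sub>F nhds y. P (fst p) (snd p)"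
proof -
  have "\<exists>N. \<forall>n\<ge>N. \<forall>z. dist z y < inverse (Suc N) \<longrightarrow> P n z"
  proof (rule ccontr)
    assume "\<not> ?thesis"
    then have "\<forall>N. \<exists>n z. n \<ge> N \<and> dist z y < inverse (Suc N) \<and> \<not> P n z"
      by blast
    then obtain m z where m: "\<And>k. k \<le> m k" and z: "\<And>k. dist (z k) y < inverse (Suc k)"
      and P: "\<And>k. \<not> P (m k) (z k)"
      by metis
    have "(\<lambda>k. dist (z k) y) \<longlonglongrightarrow> 0"
      by (rule tendsto_sandwich[OF _ _ tendsto_const LIMSEQ_inverse_real_of_nat])
        (use z in \<open>auto intro!: always_eventually less_imp_le\<close>)
    then have "z \<longlonglongrightarrow> y"
      by (rule tendsto_dist_iff[THEN iffD2])
    with assms[of m z] m P show False by blast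
  qed
  then obtain N where N: "\<And>n z. N \<le> n \<Longrightarrow> dist z y < inverse (Suc N) \<Longrightarrow> P n z"
    by blast
  have "\<forall>\<^sub>F n in sequentially. N \<le> n"
    by (rule eventually_ge_at_top)
  moreover have "\<forall>\<^sub>F z in nhds y. dist z y < inverse (Suc N)"
    using eventually_nhds_ball[of "inverse (real (Suc N))" y] by (simp add: ball_def dist_commute)
  ultimately show ?thesis
    unfolding eventually_prod_filter
    by (intro exI[of _ "\<lambda>n. N \<le> n"] exI[of _ "\<lambda>z. dist z y < inverse (Suc N)"]) (simp add: N)
qed

lemma eventually_sequentially_nhdsE:
  fixes y :: "'a::metric_space"
  assumes "\<forall>\<^sub>F p in sequentially \<times>\<^sub>F nhds y. P (fst p) (snd p)"
  obtains N \<delta> where "0 < \<delta>" "\<And>n z. N \<le> n \<Longrightarrow> dist z y < \<delta> \<Longrightarrow> P n z"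
proof -
  from assms obtain Pn Pz where Pn: "eventually Pn sequentially" and Pz: "eventually Pz (nhds y)"
    and P: "\<And>n z. Pn n \<Longrightarrow> Pz z \<Longrightarrow> P n z"
    unfolding eventually_prod_filter by auto
  from Pn obtain N where "\<And>n. N \<le> n \<Longrightarrow> Pn n"
    unfolding eventually_sequentially by blast
  moreover from Pz obtain \<delta> where "0 < \<delta>" "\<And>z. dist z y < \<delta> \<Longrightarrow> Pz z"
    unfolding eventually_nhds_metric by blast
  ultimately show thesis
    using P that[of \<delta> N] by blast
qed

text \<open>
  A bound on the \<open>\<Gamma>\<close>-limit superior is turned into a pointwise bound by a sequence that the
  axiom of continuity from above accepts.  The majorant is the sup-convolution
  \<open>u n x = sup {a m y - n * dist x y | m \<ge> n, y}\<close>, cut off at \<open>0\<close>: it is \<open>n\<close>-Lipschitz, it decreases in \<open>n\<close>, and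
  since \<open>a\<close> is bounded above, for large \<open>n\<close> only points \<open>y\<close> close to \<open>x\<close> and large
  indices \<open>m\<close> can contribute a positive value.
\<close>

lemma decreasing_continuous_majorant:
  fixes a :: "nat \<Rightarrow> 'a::metric_space \<Rightarrow> real"
  assumes bound: "\<And>n y. a n y \<le> c"
    and lim: "\<And>y \<eta>. 0 < \<eta> \<Longrightarrow> \<forall>\<^sub>F p in sequentially \<times>\<^sub>F nhds y. a (fst p) (snd p) < \<eta>"
  obtains \<theta> where "\<And>n. continuous_on UNIV (\<theta> n)" "\<And>n y. 0 \<le> \<theta> n y" "\<And>n y. \<theta> n y \<le> max 0 c"
    "\<And>n y. a n y \<le> \<theta> n y" "decreases_to_0 \<theta>"
proof -
  define u where "u n x = (SUP p\<in>{n..}\<times>UNIV. a (fst p) (snd p) - real n * dist x (snd p))" for n x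
  have bdd: "bdd_above ((\<lambda>p. a (fst p) (snd p) - real n * dist x (snd p)) ` ({n..}\<times>UNIV))" for n x
  proof (rule bdd_aboveI2)
    show "a (fst p) (snd p) - real n * dist x (snd p) \<le> c" for p
      using bound[of "fst p" "snd p"] by (smt (verit) mult_nonneg_nonneg of_nat_0_le_iff zero_le_dist)
  qed
  have u_upper: "a m y - real n * dist x y \<le> u n x" if "n \<le> m" for n m x y
    unfolding u_def by (rule cSUP_upper2[OF bdd, of "(m, y)"]) (use that in auto)
  have u_least: "u n x \<le> C" if "\<And>m y. n \<le> m \<Longrightarrow> a m y - real n * dist x y \<le> C" for n x C
    unfolding u_def using that by (intro cSUP_least) auto
  define \<theta> where "\<theta> n x = max 0 (u n x)" for n x
  have u_lip: "u n x \<le> u n x' + real n * dist x x'" for n x x'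
  proof (rule u_least)
    fix m y assume "n \<le> m"
    have "real n * dist x' y \<le> real n * dist x y + real n * dist x x'"
      unfolding distrib_left[symmetric]
      by (intro mult_left_mono) (use dist_triangle[of x' y x] in \<open>simp_all add: dist_commute\<close>)
    then show "a m y - real n * dist x y \<le> u n x' + real n * dist x x'"
      using u_upper[OF \<open>n \<le> m\<close>, of y x'] by linarith
  qed
  show thesis
  proof (rule that)
    show "continuous_on UNIV (\<theta> n)" for n
    proof -
      have "(real n)-lipschitz_on UNIV (u n)"
      proof (rule lipschitz_onI)
        show "dist (u n x) (u n y) \<le> real n * dist x y" for x y
          using u_lip[of n x y] u_lip[of n y x] by (simp add: dist_real_def abs_le_iff dist_commute)
      qed simp
      then have "continuous_on UNIV (u n)"
        by (rule lipschitz_on_continuous_on)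
      then show ?thesis
        unfolding \<theta>_def by (intro continuous_intros)
    qed
    show "0 \<le> \<theta> n y" for n y
      by (simp add: \<theta>_def)
    show "\<theta> n y \<le> max 0 c" for n y
    proof -
      have "u n y \<le> c"
        by (rule u_least) (smt (verit) bound mult_nonneg_nonneg of_nat_0_le_iff zero_le_dist)
      then show ?thesis by (auto simp: \<theta>_def)
    qed
    show "a n y \<le> \<theta> n y" for n y
      using u_upper[of n n y y] by (simp add: \<theta>_def)
    have "u n x \<le> u m x" if "m \<le> n" for m n x
    proof (rule u_least)
      fix k y assume "n \<le> k"
      have "real m * dist x y \<le> real n * dist x y"
        using that by (intro mult_right_mono) auto
      with u_upper[of m k y x] that \<open>n \<le> k\<close>
      show "a k y - real n * dist x y \<le> u m x" by simp
    qed
    then have "decseq \<theta>"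
      by (intro antimonoI le_funI) (simp add: \<theta>_def max.coboundedI2)
    moreover have "(\<lambda>n. \<theta> n x) \<longlonglongrightarrow> 0" for x
    proof (rule order_tendstoI)
      fix \<eta> :: real assume "0 < \<eta>"
      then have "0 < \<eta> / 2" by simp
      from lim[OF this, of x]
      obtain N \<delta> where \<delta>: "0 < \<delta>" and N: "\<And>n z. N \<le> n \<Longrightarrow> dist z x < \<delta> \<Longrightarrow> a n z < \<eta> / 2"
        by (rule eventually_sequentially_nhdsE) blast
      obtain M :: nat where "c / \<delta> < real M"
        using reals_Archimedean2 by blast
      then have M: "c \<le> real M * \<delta>"
        using \<delta> by (simp add: field_simps)
      have "u n x \<le> \<eta> / 2" if "max M N \<le> n" for n
      proof (rule u_least)
        fix m y assume "n \<le> m"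
        show "a m y - real n * dist x y \<le> \<eta> / 2"
        proof (cases "dist y x < \<delta>")
          case True
          with N[of m y] that \<open>n \<le> m\<close> have "a m y < \<eta> / 2" by simp
          then show ?thesis
            by (smt (verit) mult_nonneg_nonneg of_nat_0_le_iff zero_le_dist)
        next
          case False
          then have "real M * \<delta> \<le> real n * dist x y"
            using that \<delta> by (intro mult_mono) (auto simp: dist_commute)
          with M bound[of m y] \<open>0 < \<eta>\<close> show ?thesis by linarith
        qed
      qed
      then show "\<forall>\<^sub>F n in sequentially. \<theta> n x < \<eta>"
        unfolding eventually_sequentially using \<open>0 < \<eta>\<close>
        by (intro exI[of _ "max M N"]) (force simp: \<theta>_def)
    next
      fix \<eta> :: real assume "\<eta> < 0"
      then show "\<forall>\<^sub>F n in sequentially. \<eta> < \<theta> n x"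
        by (auto simp: \<theta>_def intro!: always_eventually)
    qed
    ultimately show "decreases_to_0 \<theta>"
      by (simp add: decreases_to_0_def)
  qed
qed

section \<open>The weighted space of continuous functions\<close>

locale weight =
  fixes \<kappa> :: "'a::metric_space \<Rightarrow> real"
  assumes weight_pos: "\<kappa> x > 0" and weight_continuous: "continuous_on UNIV \<kappa>"
begin

lemma weight_nonzero: "\<kappa> x \<noteq> 0"
  using weight_pos[of x] by simp

lemma wnorm_le_iff: "wnorm \<kappa> f \<le> ereal c \<longleftrightarrow> (\<forall>x. \<bar>f x\<bar> \<le> c / \<kappa> x)"
  by (simp add: wnorm_def SUP_le_iff pos_le_divide_eq weight_pos)

lemma wnorm_finiteE:
  assumes "wnorm \<kappa> f < \<infinity>"
  obtains c where "0 \<le> c" "\<And>x. \<bar>f x\<bar> \<le> c / \<kappa> x"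
proof -
  obtain n :: nat where "wnorm \<kappa> f < n"
    using assms less_PInf_Ex_of_nat[of "wnorm \<kappa> f"] by auto
  then have "wnorm \<kappa> f \<le> ereal (real n)" by simp
  then show thesis
    using that[of "real n"] by (simp add: wnorm_le_iff)
qed

lemma C_kappaI:
  assumes "continuous_on UNIV f" "\<And>x. \<bar>f x\<bar> \<le> c / \<kappa> x"
  shows "f \<in> C_kappa \<kappa>"
proof -
  have "wnorm \<kappa> f \<le> ereal c"
    using assms by (simp add: wnorm_le_iff)
  then have "wnorm \<kappa> f < \<infinity>" by (rule le_less_trans) simp
  with assms show ?thesis by (simp add: C_kappa_def)
qed

lemma C_kappaE:
  assumes "f \<in> C_kappa \<kappa>"
  obtains c where "continuous_on UNIV f" "0 \<le> c" "\<And>x. \<bar>f x\<bar> \<le> c / \<kappa> x"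
proof -
  have "continuous_on UNIV f" and "wnorm \<kappa> f < \<infinity>"
    using assms by (simp_all add: C_kappa_def)
  with that show thesis
    using wnorm_finiteE[of f thesis] by blast
qed

lemma C_kappa_tendsto:
  assumes "f \<in> C_kappa \<kappa>" "(g \<longlongrightarrow> y) F"
  shows "((\<lambda>p. f (g p)) \<longlongrightarrow> f y) F"
proof (rule isCont_tendsto_compose[OF _ assms(2)])
  show "isCont f y"
    using assms(1) by (simp add: C_kappa_def continuous_on_eq_continuous_at)
qed

lemma C_kappa_lincomb:
  assumes "f \<in> C_kappa \<kappa>" "g \<in> C_kappa \<kappa>"
  shows "(\<lambda>x. c * f x + d * g x) \<in> C_kappa \<kappa>"
proof -
  obtain a where a: "continuous_on UNIV f" "\<And>x. \<bar>f x\<bar> \<le> a / \<kappa> x"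
    using assms(1) by (rule C_kappaE) blast
  obtain b where b: "continuous_on UNIV g" "\<And>x. \<bar>g x\<bar> \<le> b / \<kappa> x"
    using assms(2) by (rule C_kappaE) blast
  show ?thesis
  proof (rule C_kappaI)
    show "continuous_on UNIV (\<lambda>x. c * f x + d * g x)"
      by (intro continuous_intros a b)
    fix x
    have "\<bar>c * f x + d * g x\<bar> \<le> \<bar>c\<bar> * \<bar>f x\<bar> + \<bar>d\<bar> * \<bar>g x\<bar>"
      by (metis abs_mult abs_triangle_ineq)
    also have "\<dots> \<le> \<bar>c\<bar> * (a / \<kappa> x) + \<bar>d\<bar> * (b / \<kappa> x)"
      by (intro add_mono mult_left_mono a b) auto
    finally show "\<bar>c * f x + d * g x\<bar> \<le> (\<bar>c\<bar> * a + \<bar>d\<bar> * b) / \<kappa> x"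
      by (simp add: add_divide_distrib)
  qed
qed

lemma C_kappa_add: "f \<in> C_kappa \<kappa> \<Longrightarrow> g \<in> C_kappa \<kappa> \<Longrightarrow> (\<lambda>x. f x + g x) \<in> C_kappa \<kappa>"
  using C_kappa_lincomb[of f g 1 1] by simp

lemma C_kappa_diff: "f \<in> C_kappa \<kappa> \<Longrightarrow> g \<in> C_kappa \<kappa> \<Longrightarrow> (\<lambda>x. f x - g x) \<in> C_kappa \<kappa>"
  using C_kappa_lincomb[of f g 1 "- 1"] by simp

lemma C_kappa_cmult: "f \<in> C_kappa \<kappa> \<Longrightarrow> (\<lambda>x. c * f x) \<in> C_kappa \<kappa>"
  using C_kappa_lincomb[of f f c 0] by simp

lemma C_kappa_weight: "(\<lambda>x. c / \<kappa> x) \<in> C_kappa \<kappa>"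
proof (rule C_kappaI)
  show "continuous_on UNIV (\<lambda>x. c / \<kappa> x)"
    by (intro continuous_on_divide continuous_on_const weight_continuous) (simp add: weight_nonzero)
  show "\<bar>c / \<kappa> x\<bar> \<le> \<bar>c\<bar> / \<kappa> x" for x
    using weight_pos[of x] by (simp add: abs_divide)
qed

lemma C_kappa_quotient: "f \<in> C_kappa \<kappa> \<Longrightarrow> g \<in> C_kappa \<kappa> \<Longrightarrow> (\<lambda>x. (f x - g x) / h) \<in> C_kappa \<kappa>"
  using C_kappa_cmult[OF C_kappa_diff, of f g "1 / h"] by simp

lemmas C_kappa_intros = C_kappa_add C_kappa_diff C_kappa_cmult C_kappa_weight C_kappa_quotient

text \<open>
  Multiplication by the weight reduces this to the unweighted majorant; continuity of \<open>\<kappa>\<close>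
  keeps the \<open>\<Gamma>\<close>-bound intact, as \<open>\<kappa>\<close> is locally bounded above.
\<close>

lemma C_kappa_majorant:
  fixes a :: "nat \<Rightarrow> 'a \<Rightarrow> real"
  assumes bound: "\<And>n y. a n y \<le> c / \<kappa> y"
    and lim: "\<And>y \<eta>. 0 < \<eta> \<Longrightarrow> \<forall>\<^sub>F p in sequentially \<times>\<^sub>F nhds y. a (fst p) (snd p) < \<eta>"
  obtains \<theta> where "\<And>n. \<theta> n \<in> C_kappa \<kappa>" "\<And>n y. 0 \<le> \<theta> n y" "\<And>n y. a n y \<le> \<theta> n y"
    "decreases_to_0 \<theta>"
proof -
  have 1: "a n y * \<kappa> y \<le> c" for n y
    using bound[of n y] weight_pos[of y] by (simp add: pos_le_divide_eq)
  have 2: "\<forall>\<^sub>F p in sequentially \<times>\<^sub>F nhds y. a (fst p) (snd p) * \<kappa> (snd p) < \<eta>"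
    if "0 < \<eta>" for y \<eta>
  proof -
    have "(\<kappa> \<longlongrightarrow> \<kappa> y) (nhds y)"
      using weight_continuous by (simp add: continuous_on_eq_continuous_at isCont_def tendsto_at_iff_tendsto_nhds)
    then have "\<forall>\<^sub>F z in nhds y. \<kappa> z < 2 * \<kappa> y"
      using weight_pos[of y] by (intro order_tendstoD) auto
    then have "\<forall>\<^sub>F p in sequentially \<times>\<^sub>F nhds y. \<kappa> (snd p) < 2 * \<kappa> y"
      by (rule eventually_compose_filterlim[OF _ filterlim_snd])
    moreover have "\<forall>\<^sub>F p in sequentially \<times>\<^sub>F nhds y. a (fst p) (snd p) < \<eta> / (2 * \<kappa> y)"
      using that weight_pos[of y] by (intro lim) auto
    ultimately show ?thesis
    proof eventually_elim
      case (elim p)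
      show ?case
      proof (cases "a (fst p) (snd p) \<le> 0")
        case True
        then have "a (fst p) (snd p) * \<kappa> (snd p) \<le> 0"
          using weight_pos[of "snd p"] by (simp add: mult_nonpos_nonneg)
        with that show ?thesis by linarith
      next
        case False
        then have "a (fst p) (snd p) * \<kappa> (snd p) < \<eta> / (2 * \<kappa> y) * (2 * \<kappa> y)"
          using elim weight_pos[of "snd p"] by (intro mult_strict_mono) auto
        then show ?thesis using weight_pos[of y] by simp
      qed
    qed
  qed
  show thesis
  proof (rule decreasing_continuous_majorant[OF 1 2])
    fix \<theta> :: "nat \<Rightarrow> 'a \<Rightarrow> real"
    assume \<theta>: "\<And>n. continuous_on UNIV (\<theta> n)" "\<And>n y. 0 \<le> \<theta> n y"
      "\<And>n y. \<theta> n y \<le> max 0 c" "\<And>n y. a n y * \<kappa> y \<le> \<theta> n y" "decreases_to_0 \<theta>"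
    show thesis
    proof (rule that)
      show "(\<lambda>y. \<theta> n y / \<kappa> y) \<in> C_kappa \<kappa>" for n
      proof (rule C_kappaI)
        show "continuous_on UNIV (\<lambda>y. \<theta> n y / \<kappa> y)"
          by (intro continuous_on_divide weight_continuous \<theta>) (simp add: weight_nonzero)
        show "\<bar>\<theta> n y / \<kappa> y\<bar> \<le> max 0 c / \<kappa> y" for y
          using \<theta>(2,3)[of n y] weight_pos[of y] by (simp add: abs_divide divide_right_mono)
      qed
      show "0 \<le> \<theta> n y / \<kappa> y" for n y
        using \<theta>(2)[of n y] weight_pos[of y] by simp
      show "a n y \<le> \<theta> n y / \<kappa> y" for n y
        using \<theta>(4)[of n y] weight_pos[of y] by (simp add: pos_le_divide_eq)
      have "(\<lambda>n. \<theta> n y / \<kappa> y) \<longlonglongrightarrow> 0" for y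
        using \<theta>(5) by (intro tendsto_divide_zero) (simp add: decreases_to_0_def)
      moreover have "decseq (\<lambda>n y. \<theta> n y / \<kappa> y)"
      proof (intro antimonoI le_funI)
        show "\<theta> n y / \<kappa> y \<le> \<theta> m y / \<kappa> y" if "m \<le> n" for m n y
          using \<theta>(5) that weight_pos[of y]
          by (intro divide_right_mono) (auto simp: decreases_to_0_def dest: antimonoD le_funD)
      qed
      ultimately show "decreases_to_0 (\<lambda>n y. \<theta> n y / \<kappa> y)"
        by (simp add: decreases_to_0_def)
    qed
  qed
qed

lemma mixed_converges_bound:
  assumes "mixed_converges \<kappa> F G"
  obtains c where "\<And>n x. \<bar>F n x\<bar> \<le> c / \<kappa> x"
proof -
  obtain N :: nat where "(SUP n. wnorm \<kappa> (F n)) < N"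
    using assms less_PInf_Ex_of_nat[of "SUP n. wnorm \<kappa> (F n)"] by (auto simp: mixed_converges_def)
  then have "wnorm \<kappa> (F n) \<le> ereal (real N)" for n
    by (meson SUP_lessD UNIV_I less_imp_le)
  then show thesis
    using that[of "real N"] by (simp add: wnorm_le_iff)
qed

text \<open>
  A convergent sequence together with its limit is compact, so uniform convergence on compacts
  controls the values along every convergent sequence of points.
\<close>

lemma mixed_converges_tendsto:
  assumes "mixed_converges \<kappa> F G"
  shows "((\<lambda>p. F (fst p) (snd p) - G (snd p)) \<longlongrightarrow> 0) (sequentially \<times>\<^sub>F nhds y)"
proof (rule tendstoI)
  fix \<eta> :: real assume "0 < \<eta>"
  show "\<forall>\<^sub>F p in sequentially \<times>\<^sub>F nhds y. dist (F (fst p) (snd p) - G (snd p)) 0 < \<eta>"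
  proof (rule eventually_sequentially_nhdsI)
    fix m :: "nat \<Rightarrow> nat" and z assume m: "\<And>k. k \<le> m k" and z: "z \<longlonglongrightarrow> y"
    have "compact (insert y (range z))"
      using z compactin_sequence_with_limit[of euclidean z y "range z"] by simp
    then have "uniform_limit (insert y (range z)) F G sequentially"
      using assms by (simp add: mixed_converges_def)
    then obtain N where N: "\<And>n x. N \<le> n \<Longrightarrow> x \<in> insert y (range z) \<Longrightarrow> dist (F n x) (G x) < \<eta>"
      using \<open>0 < \<eta>\<close> unfolding uniform_limit_iff eventually_sequentially by blast
    show "\<exists>k. dist (F (m k) (z k) - G (z k)) 0 < \<eta>"
      using N[of "m N" "z N"] m[of N] by (intro exI[of _ N]) (simp add: dist_real_def)
  qed
qed

end

section \<open>Convex monotone operators\<close>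

text \<open>
  A single time step; the composition of two steps belonging to different semigroups is again such
  an operator, although it is not a step of any one semigroup.
\<close>

locale convex_monotone_operator = weight \<kappa> for \<kappa> :: "'a::metric_space \<Rightarrow> real" +
  fixes R :: "('a \<Rightarrow> real) \<Rightarrow> ('a \<Rightarrow> real)"
  assumes maps_to: "f \<in> C_kappa \<kappa> \<Longrightarrow> R f \<in> C_kappa \<kappa>"
    and convex: "f \<in> C_kappa \<kappa> \<Longrightarrow> g \<in> C_kappa \<kappa> \<Longrightarrow> 0 \<le> c \<Longrightarrow> c \<le> 1 \<Longrightarrow>
      R (\<lambda>y. c * f y + (1 - c) * g y) x \<le> c * R f x + (1 - c) * R g x"
    and monotone: "f \<in> C_kappa \<kappa> \<Longrightarrow> g \<in> C_kappa \<kappa> \<Longrightarrow> (\<And>y. f y \<le> g y) \<Longrightarrow> R f x \<le> R g x"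
    and continuous_from_above: "(\<And>n. \<theta> n \<in> C_kappa \<kappa>) \<Longrightarrow> decreases_to_0 \<theta> \<Longrightarrow>
      (\<lambda>n. R (\<theta> n) x) \<longlonglongrightarrow> 0"
begin

lemma maps_zero: "R (\<lambda>_. 0) x = 0"
proof -
  have "(\<lambda>n. R (\<lambda>_. 0) x) \<longlonglongrightarrow> 0"
    using C_kappa_weight[of 0]
    by (intro continuous_from_above) (simp_all add: decreases_to_0_def decseq_def)
  then show ?thesis
    by (simp add: LIMSEQ_const_iff)
qed

text \<open>
  Convexity in incremental form, as needed for estimates whose error carries a factor \<open>c\<close>.
\<close>

lemma convex_diff:
  assumes "f \<in> C_kappa \<kappa>" "g \<in> C_kappa \<kappa>" "0 \<le> c" "c \<le> 1"
  shows "R (\<lambda>y. f y + c * (g y - f y)) x - R f x \<le> c * (R g x - R f x)"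
proof -
  have "(\<lambda>y. f y + c * (g y - f y)) = (\<lambda>y. c * g y + (1 - c) * f y)"
    by (simp add: fun_eq_iff algebra_simps)
  then show ?thesis
    using convex[OF assms(2,1,3,4), of x] by (simp add: algebra_simps)
qed

lemma difference_quotient_mono:
  assumes "f \<in> C_kappa \<kappa>" "b \<in> C_kappa \<kappa>" "0 < h" "h \<le> \<epsilon>"
  shows "(R (\<lambda>y. f y + h * b y) x - R f x) / h \<le> (R (\<lambda>y. f y + \<epsilon> * b y) x - R f x) / \<epsilon>"
proof -
  have "R (\<lambda>y. f y + h / \<epsilon> * (f y + \<epsilon> * b y - f y)) x - R f x
      \<le> h / \<epsilon> * (R (\<lambda>y. f y + \<epsilon> * b y) x - R f x)"
    using assms by (intro convex_diff C_kappa_intros) auto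
  then show ?thesis
    using assms by (simp add: field_simps)
qed

text \<open>
  Convexity bounds values from above.  The midpoint inequality gives lower bounds too: it converts an
  upper bound at the reflected point \<open>f + g\<close> into a lower bound at \<open>f - g\<close>.
\<close>

lemma reflect:
  assumes "f \<in> C_kappa \<kappa>" "g \<in> C_kappa \<kappa>"
  shows "2 * R f x \<le> R (\<lambda>y. f y + g y) x + R (\<lambda>y. f y - g y) x"
proof -
  have "R (\<lambda>y. (1/2) * (f y + g y) + (1 - 1/2) * (f y - g y)) x
     \<le> (1/2) * R (\<lambda>y. f y + g y) x + (1 - 1/2) * R (\<lambda>y. f y - g y) x"
    using assms by (intro convex C_kappa_intros) auto
  moreover have "(\<lambda>y. (1/2) * (f y + g y) + (1 - 1/2) * (f y - g y)) = f"
    by (simp add: fun_eq_iff field_simps)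
  ultimately show ?thesis
    by simp
qed

lemma abs_le_weight:
  assumes "f \<in> C_kappa \<kappa>" "\<And>y. \<bar>f y\<bar> \<le> c / \<kappa> y"
  shows "\<bar>R f x\<bar> \<le> R (\<lambda>y. c / \<kappa> y) x"
proof -
  have "R f x \<le> R (\<lambda>y. c / \<kappa> y) x"
    using assms by (intro monotone C_kappa_intros) (auto simp: abs_le_iff)
  moreover have "R (\<lambda>y. 0 - f y) x \<le> R (\<lambda>y. c / \<kappa> y) x"
    using assms C_kappa_weight[of 0] by (intro monotone C_kappa_intros) (auto simp: abs_le_iff)
  moreover have "2 * R (\<lambda>_. 0) x \<le> R (\<lambda>y. 0 + f y) x + R (\<lambda>y. 0 - f y) x"
    using assms C_kappa_weight[of 0] by (intro reflect) auto
  ultimately show ?thesis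
    by (simp add: maps_zero)
qed

text \<open>
  Lipschitz continuity on bounded sets with respect to the weighted norm, in one-sided form.  The
  function \<open>f + \<epsilon> / \<kappa>\<close> lies at the fraction \<open>\<epsilon>\<close> of the segment from \<open>f\<close> to
  \<open>f + 1 / \<kappa>\<close>, so that convexity produces the factor \<open>\<epsilon>\<close>.
\<close>

lemma weight_perturbation:
  assumes "f \<in> C_kappa \<kappa>" "g \<in> C_kappa \<kappa>" "\<And>y. \<bar>f y\<bar> \<le> c / \<kappa> y"
    and le: "\<And>y. g y \<le> f y + \<epsilon> / \<kappa> y" and "0 \<le> \<epsilon>" "\<epsilon> \<le> 1"
  shows "R g x \<le> R f x + 2 * \<epsilon> * R (\<lambda>y. (c + 1) / \<kappa> y) x"
proof -
  let ?u = "\<lambda>y. f y + 1 / \<kappa> y"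
  have u: "?u \<in> C_kappa \<kappa>"
    using assms by (intro C_kappa_intros)
  have "R g x \<le> R (\<lambda>y. f y + \<epsilon> * (?u y - f y)) x"
    using assms le by (intro monotone C_kappa_intros) auto
  also have "\<dots> \<le> R f x + \<epsilon> * (R ?u x - R f x)"
    using convex_diff[OF assms(1) u assms(5,6), of x] by simp
  also have "\<dots> \<le> R f x + \<epsilon> * (2 * R (\<lambda>y. (c + 1) / \<kappa> y) x)"
  proof -
    have b: "\<bar>f y\<bar> \<le> (c + 1) / \<kappa> y" "\<bar>?u y\<bar> \<le> (c + 1) / \<kappa> y" for y
    proof -
      have "0 < 1 / \<kappa> y"
        by (simp add: weight_pos)
      with assms(3)[of y] show "\<bar>f y\<bar> \<le> (c + 1) / \<kappa> y" "\<bar>?u y\<bar> \<le> (c + 1) / \<kappa> y"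
        unfolding add_divide_distrib by linarith+
    qed
    show ?thesis
      using abs_le_weight[OF assms(1) b(1), of x] abs_le_weight[OF u b(2), of x] assms(5)
      by (intro add_left_mono mult_left_mono) auto
  qed
  finally show ?thesis
    by simp
qed

text \<open>
  Convexity transports continuity from above from \<open>0\<close> to any \<open>f\<close>.  Since
  \<open>f + \<theta> = (1 - l) f + l (f + \<theta> / l)\<close>, and \<open>f + \<theta> / l\<close> is the midpoint of \<open>2 f\<close> and
  \<open>2 \<theta> / l\<close>, the excess over \<open>R f\<close> is at most \<open>l\<close> times a constant plus a multiple of
  \<open>R (2 \<theta> / l)\<close>; the first part is small with \<open>l\<close>, the second tends to \<open>0\<close> for fixed \<open>l\<close>.
\<close>

lemma continuous_from_above_at:
  assumes f: "f \<in> C_kappa \<kappa>" and \<theta>: "\<And>n. \<theta> n \<in> C_kappa \<kappa>" "decreases_to_0 \<theta>" "\<And>n y. 0 \<le> \<theta> n y"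
  shows "(\<lambda>n. R (\<lambda>y. f y + \<theta> n y) x) \<longlonglongrightarrow> R f x"
proof (rule order_tendstoI)
  fix a assume "a < R f x"
  moreover have "R f x \<le> R (\<lambda>y. f y + \<theta> n y) x" for n
    using f \<theta> by (intro monotone C_kappa_intros) auto
  ultimately show "\<forall>\<^sub>F n in sequentially. a < R (\<lambda>y. f y + \<theta> n y) x"
    by (intro always_eventually) (auto intro: less_le_trans)
next
  fix a assume "R f x < a"
  define K where "K = \<bar>R (\<lambda>y. 2 * f y) x / 2 - R f x\<bar> + 1"
  define l where "l = min 1 ((a - R f x) / (2 * K))"
  have "0 < K"
    unfolding K_def by linarith
  then have l: "0 < l" "l \<le> 1"
    using \<open>R f x < a\<close> by (auto simp: l_def)
  have lK: "l * (R (\<lambda>y. 2 * f y) x / 2 - R f x) \<le> (a - R f x) / 2"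
  proof -
    have "l * (R (\<lambda>y. 2 * f y) x / 2 - R f x) \<le> l * K"
      using l unfolding K_def by (intro mult_left_mono) linarith+
    also have "\<dots> \<le> (a - R f x) / (2 * K) * K"
      using \<open>0 < K\<close> by (intro mult_right_mono) (auto simp: l_def)
    finally show ?thesis
      using \<open>0 < K\<close> by simp
  qed
  have le: "R (\<lambda>y. f y + \<theta> n y) x
      \<le> R f x + l * (R (\<lambda>y. 2 * f y) x / 2 - R f x) + (l / 2) * R (\<lambda>y. (2 / l) * \<theta> n y) x" for n
  proof -
    have "R (\<lambda>y. f y + l * ((f y + (1 / l) * \<theta> n y) - f y)) x - R f x
        \<le> l * (R (\<lambda>y. f y + (1 / l) * \<theta> n y) x - R f x)"
      using f \<theta> l by (intro convex_diff C_kappa_intros) auto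
    moreover have "R (\<lambda>y. (1/2) * (2 * f y) + (1 - 1/2) * ((2 / l) * \<theta> n y)) x
        \<le> (1/2) * R (\<lambda>y. 2 * f y) x + (1 - 1/2) * R (\<lambda>y. (2 / l) * \<theta> n y) x"
      using f \<theta> by (intro convex C_kappa_intros) auto
    then have "l * R (\<lambda>y. f y + (1 / l) * \<theta> n y) x
        \<le> l * ((1/2) * R (\<lambda>y. 2 * f y) x + (1/2) * R (\<lambda>y. (2 / l) * \<theta> n y) x)"
      using l by (intro mult_left_mono) auto
    ultimately show ?thesis
      using l by (simp add: algebra_simps)
  qed
  have "(\<lambda>n. R (\<lambda>y. (2 / l) * \<theta> n y) x) \<longlonglongrightarrow> 0"
  proof (rule continuous_from_above)
    show "(\<lambda>y. (2 / l) * \<theta> n y) \<in> C_kappa \<kappa>" for n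
      using \<theta> by (intro C_kappa_intros)
    have "decseq (\<lambda>n y. (2 / l) * \<theta> n y)"
      using \<theta>(2) l unfolding decreases_to_0_def
      by (intro antimonoI le_funI mult_left_mono) (auto dest: antimonoD le_funD)
    moreover have "(\<lambda>n. (2 / l) * \<theta> n y) \<longlonglongrightarrow> 0" for y
      using \<theta>(2) unfolding decreases_to_0_def by (intro tendsto_mult_right_zero) auto
    ultimately show "decreases_to_0 (\<lambda>n y. (2 / l) * \<theta> n y)"
      unfolding decreases_to_0_def by blast
  qed
  then have "(\<lambda>n. (l / 2) * R (\<lambda>y. (2 / l) * \<theta> n y) x) \<longlonglongrightarrow> 0"
    by (rule tendsto_mult_right_zero)
  moreover have "0 < (a - R f x) / 2"
    using \<open>R f x < a\<close> by simp
  ultimately have "\<forall>\<^sub>F n in sequentially. (l / 2) * R (\<lambda>y. (2 / l) * \<theta> n y) x < (a - R f x) / 2"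
    by (rule order_tendstoD(2))
  then show "\<forall>\<^sub>F n in sequentially. R (\<lambda>y. f y + \<theta> n y) x < a"
  proof eventually_elim
    case (elim n)
    have "R (\<lambda>y. f y + \<theta> n y) x < R f x + (a - R f x) / 2 + (a - R f x) / 2"
      by (rule le_less_trans[OF le add_le_less_mono[OF add_left_mono[OF lK] elim]])
    then show ?case by (simp add: field_simps)
  qed
qed

text \<open>
  Sequential continuity for the mixed topology, also along moving points.  The distance of
  \<open>a n\<close> to \<open>f\<close> has a decreasing majorant \<open>\<theta> n\<close>; then \<open>R (f + \<theta> n)\<close> bounds \<open>R (a n)\<close> from
  above and, by reflection at \<open>f\<close>, also from below.  A Dini argument handles the moving points: the
  functions \<open>R (f + \<theta> n)\<close> are continuous and decrease to the continuous function \<open>R f\<close>.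
\<close>

lemma continuous_convergence:
  assumes f: "f \<in> C_kappa \<kappa>" and a: "\<And>n. a n \<in> C_kappa \<kappa>"
    and bound: "\<And>n y. \<bar>a n y - f y\<bar> \<le> c / \<kappa> y"
    and lim: "\<And>y. ((\<lambda>p. a (fst p) (snd p) - f (snd p)) \<longlongrightarrow> 0) (sequentially \<times>\<^sub>F nhds y)"
    and xs: "xs \<longlonglongrightarrow> x"
  shows "(\<lambda>n. R (a n) (xs n)) \<longlonglongrightarrow> R f x"
proof -
  have "\<forall>\<^sub>F p in sequentially \<times>\<^sub>F nhds y. \<bar>a (fst p) (snd p) - f (snd p)\<bar> < \<eta>" if "0 < \<eta>" for y \<eta>
    using order_tendstoD(2)[OF tendsto_rabs_zero[OF lim] that] .
  then obtain \<theta> where \<theta>: "\<And>n. \<theta> n \<in> C_kappa \<kappa>" "\<And>n y. 0 \<le> \<theta> n y"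
    "\<And>n y. \<bar>a n y - f y\<bar> \<le> \<theta> n y" "decreases_to_0 \<theta>"
    using C_kappa_majorant[of "\<lambda>n y. \<bar>a n y - f y\<bar>" c] bound by auto
  have up: "\<forall>\<^sub>F n in sequentially. R (\<lambda>y. f y + \<theta> n y) (xs n) < u" if "R f x < u" for u
  proof -
    from order_tendstoD(2)[OF continuous_from_above_at[OF f \<theta>(1,4,2)] that]
    obtain m where "R (\<lambda>y. f y + \<theta> m y) x < u"
      unfolding eventually_sequentially by blast
    moreover have "(\<lambda>n. R (\<lambda>y. f y + \<theta> m y) (xs n)) \<longlonglongrightarrow> R (\<lambda>y. f y + \<theta> m y) x"
      using f \<theta> xs by (intro C_kappa_tendsto maps_to C_kappa_intros)
    ultimately have "\<forall>\<^sub>F n in sequentially. R (\<lambda>y. f y + \<theta> m y) (xs n) < u"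
      using order_tendstoD(2) by blast
    moreover have "\<forall>\<^sub>F n in sequentially. m \<le> n"
      by (rule eventually_ge_at_top)
    ultimately show ?thesis
    proof eventually_elim
      case (elim n)
      have "R (\<lambda>y. f y + \<theta> n y) (xs n) \<le> R (\<lambda>y. f y + \<theta> m y) (xs n)"
        using f \<theta> elim(2) unfolding decreases_to_0_def
        by (intro monotone C_kappa_intros add_left_mono) (auto dest: antimonoD le_funD)
      with elim show ?case by linarith
    qed
  qed
  have upper: "R (a n) z \<le> R (\<lambda>y. f y + \<theta> n y) z" for n z
  proof (intro monotone C_kappa_intros f \<theta> a)
    show "a n y \<le> f y + \<theta> n y" for y
      using \<theta>(3)[of n y] by linarith
  qed
  have lower: "2 * R f z - R (\<lambda>y. f y + \<theta> n y) z \<le> R (a n) z" for n z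
  proof -
    have "2 * R f z \<le> R (\<lambda>y. f y + (f y - a n y)) z + R (\<lambda>y. f y - (f y - a n y)) z"
      by (intro reflect C_kappa_intros f a)
    moreover have "R (\<lambda>y. f y + (f y - a n y)) z \<le> R (\<lambda>y. f y + \<theta> n y) z"
    proof (intro monotone C_kappa_intros f \<theta> a)
      show "f y + (f y - a n y) \<le> f y + \<theta> n y" for y
        using \<theta>(3)[of n y] by linarith
    qed
    ultimately show ?thesis by simp
  qed
  have Rf: "(\<lambda>n. R f (xs n)) \<longlonglongrightarrow> R f x"
    by (intro C_kappa_tendsto maps_to f xs)
  show ?thesis
  proof (rule order_tendstoI)
    fix u assume "R f x < u"
    from up[OF this] show "\<forall>\<^sub>F n in sequentially. R (a n) (xs n) < u"
      by eventually_elim (use upper le_less_trans in blast)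
  next
    fix u assume u: "u < R f x"
    then have "R f x < R f x + (R f x - u) / 2" "R f x - (R f x - u) / 4 < R f x"
      by auto
    with up order_tendstoD(1)[OF Rf]
    have "\<forall>\<^sub>F n in sequentially. R (\<lambda>y. f y + \<theta> n y) (xs n) < R f x + (R f x - u) / 2"
      "\<forall>\<^sub>F n in sequentially. R f x - (R f x - u) / 4 < R f (xs n)"
      by blast+
    then show "\<forall>\<^sub>F n in sequentially. u < R (a n) (xs n)"
    proof eventually_elim
      case (elim n)
      with lower[of "xs n" n] show ?case by (simp add: field_simps)
    qed
  qed
qed

end

lemma convex_monotone_operator_comp:
  assumes "convex_monotone_operator \<kappa> P" "convex_monotone_operator \<kappa> R"
    and dec: "\<And>\<theta>. (\<And>n. \<theta> n \<in> C_kappa \<kappa>) \<Longrightarrow> decreases_to_0 \<theta> \<Longrightarrow> decreases_to_0 (\<lambda>n. R (\<theta> n))"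
  shows "convex_monotone_operator \<kappa> (\<lambda>f. P (R f))"
proof -
  interpret P: convex_monotone_operator \<kappa> P by fact
  interpret R: convex_monotone_operator \<kappa> R by fact
  show ?thesis
  proof
    show "P (R f) \<in> C_kappa \<kappa>" if "f \<in> C_kappa \<kappa>" for f
      using that by (intro P.maps_to R.maps_to)
    show "P (R f) x \<le> P (R g) x" if "f \<in> C_kappa \<kappa>" "g \<in> C_kappa \<kappa>" "\<And>y. f y \<le> g y" for f g x
      using that by (intro P.monotone R.monotone R.maps_to)
    show "(\<lambda>n. P (R (\<theta> n)) x) \<longlonglongrightarrow> 0" if "\<And>n. \<theta> n \<in> C_kappa \<kappa>" "decreases_to_0 \<theta>" for \<theta> x
      using that by (intro P.continuous_from_above R.maps_to dec)
    fix f g c x assume *: "f \<in> C_kappa \<kappa>" "g \<in> C_kappa \<kappa>" "0 \<le> c" "c \<le> (1::real)"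
    have "P (R (\<lambda>y. c * f y + (1 - c) * g y)) x \<le> P (\<lambda>y. c * R f y + (1 - c) * R g y) x"
      using * by (intro P.monotone R.maps_to R.convex P.C_kappa_lincomb)
    also have "\<dots> \<le> c * P (R f) x + (1 - c) * P (R g) x"
      using * by (intro P.convex R.maps_to)
    finally show "P (R (\<lambda>y. c * f y + (1 - c) * g y)) x \<le> c * P (R f) x + (1 - c) * P (R g) x" .
  qed
qed

section \<open>Convex monotone semigroups\<close>

lemma limsup_le_Gamma_limsup_within:
  assumes "\<And>n. s n \<in> I" "s \<longlonglongrightarrow> t" "xs \<longlonglongrightarrow> x"
  shows "limsup (\<lambda>n. f (s n) (xs n)) \<le> Gamma_limsup_within I t f x"
proof -
  have "limsup (\<lambda>n. f (s n) (xs n)) \<le> Gamma_limsup (\<lambda>n. f (s n)) x"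
    unfolding Gamma_limsup_def using assms(3) by (intro Sup_upper) auto
  also have "\<dots> \<le> Gamma_limsup_within I t f x"
    unfolding Gamma_limsup_within_def using assms(1,2) by (intro Sup_upper) auto
  finally show ?thesis .
qed

lemma Gamma_limsup_within_le:
  assumes "\<And>s xs. (\<And>n. s n \<in> I) \<Longrightarrow> s \<longlonglongrightarrow> t \<Longrightarrow> xs \<longlonglongrightarrow> x \<Longrightarrow> limsup (\<lambda>n. f (s n) (xs n)) \<le> C"
  shows "Gamma_limsup_within I t f x \<le> C"
  unfolding Gamma_limsup_within_def Gamma_limsup_def
  by (intro Sup_least) (auto intro!: Sup_least assms)

locale weighted_semigroup = weight \<kappa> + convex_monotone_semigroup \<kappa> S
  for \<kappa> :: "'a::polish_space \<Rightarrow> real" and S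
begin

lemma operator: "convex_monotone_operator \<kappa> (S t)" if "0 \<le> t"
proof
  show "S t f x \<le> S t g x" if "f \<in> C_kappa \<kappa>" "g \<in> C_kappa \<kappa>" "\<And>y. f y \<le> g y" for f g x
    using monotone[OF \<open>0 \<le> t\<close> that(1,2)] that(3) by (simp add: le_fun_def)
  show "(\<lambda>n. S t (\<theta> n) x) \<longlonglongrightarrow> 0" if "\<And>n. \<theta> n \<in> C_kappa \<kappa>" "decreases_to_0 \<theta>" for \<theta> x
    using continuous_from_above[OF \<open>0 \<le> t\<close> that] by (simp add: decreases_to_0_def)
qed (use maps_to convex that in auto)

lemma locally_bounded_weight:
  assumes "0 \<le> c" "0 \<le> t"
  obtains M where "0 \<le> M" "\<And>r x. 0 \<le> r \<Longrightarrow> r \<le> t \<Longrightarrow> S r (\<lambda>y. c / \<kappa> y) x \<le> M / \<kappa> x"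
proof -
  obtain N :: nat where N: "(SUP r\<in>{0..t}. wnorm \<kappa> (S r (\<lambda>y. c / \<kappa> y))) < N"
    using locally_bounded[OF assms] less_PInf_Ex_of_nat[of "SUP r\<in>{0..t}. wnorm \<kappa> (S r (\<lambda>y. c / \<kappa> y))"]
    by auto
  have "S r (\<lambda>y. c / \<kappa> y) x \<le> real N / \<kappa> x" if "0 \<le> r" "r \<le> t" for r x
  proof -
    have "wnorm \<kappa> (S r (\<lambda>y. c / \<kappa> y)) < N"
      by (rule SUP_lessD[OF N]) (use that in auto)
    then have "wnorm \<kappa> (S r (\<lambda>y. c / \<kappa> y)) \<le> ereal (real N)"
      by simp
    then show ?thesis
      unfolding wnorm_le_iff by (auto simp: abs_le_iff)
  qed
  then show thesis
    using that[of "real N"] by simp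
qed

lemma locally_bounded_orbit:
  assumes "f \<in> C_kappa \<kappa>" "0 \<le> t"
  obtains M where "0 \<le> M" "\<And>r x. 0 \<le> r \<Longrightarrow> r \<le> t \<Longrightarrow> \<bar>S r f x\<bar> \<le> M / \<kappa> x"
proof -
  obtain c where c: "0 \<le> c" "\<And>x. \<bar>f x\<bar> \<le> c / \<kappa> x"
    using assms(1) by (rule C_kappaE) blast
  obtain M where M: "0 \<le> M" "\<And>r x. 0 \<le> r \<Longrightarrow> r \<le> t \<Longrightarrow> S r (\<lambda>y. c / \<kappa> y) x \<le> M / \<kappa> x"
    using locally_bounded_weight[OF c(1) assms(2)] by blast
  have "\<bar>S r f x\<bar> \<le> M / \<kappa> x" if "0 \<le> r" "r \<le> t" for r x
    using convex_monotone_operator.abs_le_weight[OF operator[OF that(1)] assms(1) c(2)] M(2)[OF that]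
    by (rule order_trans)
  with M(1) show thesis by (rule that)
qed

lemma locally_uniform_perturbation:
  assumes "0 \<le> c" "0 \<le> t"
  obtains L where "0 \<le> L" "\<And>r f g \<epsilon> x. \<lbrakk>0 \<le> r; r \<le> t; f \<in> C_kappa \<kappa>; g \<in> C_kappa \<kappa>; \<And>y. \<bar>f y\<bar> \<le> c / \<kappa> y;
    0 \<le> \<epsilon>; \<epsilon> \<le> 1; \<And>y. g y \<le> f y + \<epsilon> / \<kappa> y\<rbrakk> \<Longrightarrow> S r g x \<le> S r f x + L * \<epsilon> / \<kappa> x"
proof -
  from assms have "0 \<le> c + 1" by simp
  then obtain M where M: "0 \<le> M"
    "\<And>r x. 0 \<le> r \<Longrightarrow> r \<le> t \<Longrightarrow> S r (\<lambda>y. (c + 1) / \<kappa> y) x \<le> M / \<kappa> x"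
    using locally_bounded_weight[OF _ assms(2)] by blast
  show thesis
  proof (rule that)
    show "0 \<le> 2 * M"
      using M(1) by simp
    fix r f g \<epsilon> x
    assume r: "0 \<le> r" "r \<le> t" and fg: "f \<in> C_kappa \<kappa>" "g \<in> C_kappa \<kappa>" "\<And>y. \<bar>f y\<bar> \<le> c / \<kappa> y"
      and \<epsilon>: "0 \<le> \<epsilon>" "\<epsilon> \<le> 1" and le: "\<And>y. g y \<le> f y + \<epsilon> / \<kappa> y"
    have "S r g x \<le> S r f x + 2 * \<epsilon> * S r (\<lambda>y. (c + 1) / \<kappa> y) x"
      by (rule convex_monotone_operator.weight_perturbation[OF operator[OF r(1)] fg le \<epsilon>])
    also have "\<dots> \<le> S r f x + 2 * \<epsilon> * (M / \<kappa> x)"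
      using M(2)[OF r] \<epsilon> by (intro add_left_mono mult_left_mono) auto
    finally show "S r g x \<le> S r f x + 2 * M * \<epsilon> / \<kappa> x"
      by (simp add: mult.assoc mult.commute mult.left_commute)
  qed
qed

lemma limsup_time:
  assumes "f \<in> C_kappa \<kappa>" "\<And>n. 0 \<le> s n" "s \<longlonglongrightarrow> t"
  shows "limsup (\<lambda>n. ereal (S (s n) f x)) \<le> ereal (S t f x)"
proof -
  have t: "0 \<le> t"
    using assms(2,3) LIMSEQ_le_const by blast
  have "limsup (\<lambda>n. ereal (S (s n) f x)) \<le> Gamma_limsup_within {0..} t (\<lambda>s x. ereal (S s f x)) x"
    using assms limsup_le_Gamma_limsup_within[of s "{0..}" t "\<lambda>_. x" x "\<lambda>s x. ereal (S s f x)"] by simp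
  also have "\<dots> \<le> ereal (S t f x)"
    using Gamma_usc[OF t assms(1)] by (simp add: le_fun_def)
  finally show ?thesis .
qed

text \<open>
  By the axiom on \<open>\<Gamma>\<close>-limits in time, \<open>r \<mapsto> S r f x\<close> is upper semicontinuous, hence Borel
  measurable, and it is locally bounded.  The time is truncated at \<open>0\<close> because \<open>S r\<close> is unspecified for
  negative \<open>r\<close>.
\<close>

lemma integrable_time:
  assumes "f \<in> C_kappa \<kappa>"
  shows "(\<lambda>r. S (max r 0) f x) absolutely_integrable_on {a..b}"
proof -
  have "closed {r. u \<le> S (max r 0) f x}" for u
    unfolding closed_sequential_limits
  proof (intro allI impI, elim conjE, clarify)
    fix s l assume s: "\<forall>n. s n \<in> {r. u \<le> S (max r 0) f x}" "s \<longlonglongrightarrow> l"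
    have "(\<lambda>n. max (s n) 0) \<longlonglongrightarrow> max l 0"
      using s(2) by (intro tendsto_intros)
    then have "limsup (\<lambda>n. ereal (S (max (s n) 0) f x)) \<le> ereal (S (max l 0) f x)"
      by (intro limsup_time assms) auto
    moreover have "ereal u \<le> limsup (\<lambda>n. ereal (S (max (s n) 0) f x))"
      using s(1) by (intro le_Limsup always_eventually) auto
    ultimately show "u \<le> S (max l 0) f x"
      using order_trans ereal_less_eq(3) by blast
  qed
  then have "(\<lambda>r. S (max r 0) f x) \<in> borel_measurable borel"
    unfolding borel_measurable_iff_ge by (auto intro: borel_closed)
  then have meas: "(\<lambda>r. S (max r 0) f x) \<in> borel_measurable (lebesgue_on {a..b})"
    by (intro measurable_restrict_space1 measurable_completion) (simp add: measurable_lborel1)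
  obtain M where M: "0 \<le> M" "\<And>r x. 0 \<le> r \<Longrightarrow> r \<le> max b 0 \<Longrightarrow> \<bar>S r f x\<bar> \<le> M / \<kappa> x"
    using locally_bounded_orbit[OF assms, of "max b 0"] by auto
  show ?thesis
  proof (rule measurable_bounded_by_integrable_imp_absolutely_integrable[OF meas])
    show "(\<lambda>_. M / \<kappa> x) integrable_on {a..b}"
      by (rule integrable_const_ivl)
    show "norm (S (max r 0) f x) \<le> M / \<kappa> x" if "r \<in> {a..b}" for r
      using M(2)[of "max r 0"] that by auto
  qed auto
qed

text \<open>
  From the (upper) Lipschitz sets only the following one-sided estimates are used: growth under
  \<open>S h\<close> is at most linear in \<open>h\<close>, respectively decrease is at most linear.
\<close>

lemma upper_lipschitz_setE:
  assumes "f \<in> upper_lipschitz_set \<kappa> S"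
  obtains C \<delta> where "0 \<le> C" "0 < \<delta>" "\<And>h x. 0 < h \<Longrightarrow> h < \<delta> \<Longrightarrow> S h f x \<le> f x + C * h / \<kappa> x"
proof -
  have "Limsup (at_right 0) (\<lambda>h. wnorm \<kappa> (\<lambda>x. max (S h f x - f x) 0 / h)) < \<infinity>" (is "?L < _")
    using assms by (simp add: upper_lipschitz_set_def)
  then obtain N :: nat where "?L < N"
    using less_PInf_Ex_of_nat[of ?L] by auto
  then have "\<forall>\<^sub>F h in at_right 0. wnorm \<kappa> (\<lambda>x. max (S h f x - f x) 0 / h) < N"
    by (rule Limsup_lessD)
  then obtain \<delta> where \<delta>: "0 < \<delta>" "\<And>h. 0 < h \<Longrightarrow> h < \<delta> \<Longrightarrow> wnorm \<kappa> (\<lambda>x. max (S h f x - f x) 0 / h) < N"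
    unfolding eventually_at_right_field by blast
  show thesis
  proof (rule that)
    show "S h f x \<le> f x + real N * h / \<kappa> x" if h: "0 < h" "h < \<delta>" for h x
    proof -
      have "wnorm \<kappa> (\<lambda>x. max (S h f x - f x) 0 / h) \<le> ereal (real N)"
        using \<delta>(2)[OF h] by simp
      then have "\<bar>max (S h f x - f x) 0 / h\<bar> \<le> real N / \<kappa> x"
        unfolding wnorm_le_iff by blast
      then have "max (S h f x - f x) 0 \<le> real N / \<kappa> x * h"
        using h by (simp add: pos_divide_le_eq)
      then show ?thesis by simp
    qed
  qed (use \<delta> in auto)
qed

lemma lipschitz_setE:
  assumes "f \<in> lipschitz_set \<kappa> S"
  obtains C \<delta> where "0 \<le> C" "0 < \<delta>" "\<And>h x. 0 < h \<Longrightarrow> h < \<delta> \<Longrightarrow> f x \<le> S h f x + C * h / \<kappa> x"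
proof -
  have "Limsup (at_right 0) (\<lambda>h. wnorm \<kappa> (\<lambda>x. (S h f x - f x) / h)) < \<infinity>" (is "?L < _")
    using assms by (simp add: lipschitz_set_def)
  then obtain N :: nat where "?L < N"
    using less_PInf_Ex_of_nat[of ?L] by auto
  then have "\<forall>\<^sub>F h in at_right 0. wnorm \<kappa> (\<lambda>x. (S h f x - f x) / h) < N"
    by (rule Limsup_lessD)
  then obtain \<delta> where \<delta>: "0 < \<delta>" "\<And>h. 0 < h \<Longrightarrow> h < \<delta> \<Longrightarrow> wnorm \<kappa> (\<lambda>x. (S h f x - f x) / h) < N"
    unfolding eventually_at_right_field by blast
  show thesis
  proof (rule that)
    show "f x \<le> S h f x + real N * h / \<kappa> x" if h: "0 < h" "h < \<delta>" for h x
    proof -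
      have "wnorm \<kappa> (\<lambda>x. (S h f x - f x) / h) \<le> ereal (real N)"
        using \<delta>(2)[OF h] by simp
      then have "\<bar>(S h f x - f x) / h\<bar> \<le> real N / \<kappa> x"
        unfolding wnorm_le_iff by blast
      then have "\<bar>S h f x - f x\<bar> \<le> real N / \<kappa> x * h"
        using h by (simp add: pos_divide_le_eq abs_divide)
      then show ?thesis by simp
    qed
  qed (use \<delta> in auto)
qed

text \<open>
  Everything that the generator says about the difference quotients along one null sequence of times.
\<close>

lemma generator_sequence:
  assumes "(f, b) \<in> generator \<kappa> S" "\<And>n. 0 < h n" "h \<longlonglongrightarrow> 0"
  obtains c where "f \<in> C_kappa \<kappa>" "b \<in> C_kappa \<kappa>" "\<And>n. (\<lambda>x. (S (h n) f x - f x) / h n) \<in> C_kappa \<kappa>"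
    "\<And>n x. \<bar>(S (h n) f x - f x) / h n\<bar> \<le> c / \<kappa> x" "\<And>n x. \<bar>(S (h n) f x - f x) / h n - b x\<bar> \<le> c / \<kappa> x"
    "\<And>y. ((\<lambda>p. (S (h (fst p)) f (snd p) - f (snd p)) / h (fst p) - b (snd p)) \<longlongrightarrow> 0) (sequentially \<times>\<^sub>F nhds y)"
proof -
  have f: "f \<in> C_kappa \<kappa>" and b: "b \<in> C_kappa \<kappa>"
    and conv: "mixed_converges \<kappa> (\<lambda>n x. (S (h n) f x - f x) / h n) b"
    using assms by (auto simp: generator_def)
  obtain c where c: "\<And>n x. \<bar>(S (h n) f x - f x) / h n\<bar> \<le> c / \<kappa> x"
    using mixed_converges_bound[OF conv] by blast
  obtain d where d: "0 \<le> d" "\<And>x. \<bar>b x\<bar> \<le> d / \<kappa> x"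
    using b by (rule C_kappaE) blast
  show thesis
  proof (rule that[OF f b])
    show "(\<lambda>x. (S (h n) f x - f x) / h n) \<in> C_kappa \<kappa>" for n
      using f assms(2)[of n] by (intro C_kappa_quotient maps_to) auto
    fix n x
    have "\<bar>b x\<bar> \<le> d / \<kappa> x" "\<bar>(S (h n) f x - f x) / h n\<bar> \<le> c / \<kappa> x" "0 \<le> d / \<kappa> x"
      using c d weight_pos[of x] by (auto simp: less_imp_le)
    then show "\<bar>(S (h n) f x - f x) / h n\<bar> \<le> (c + d) / \<kappa> x"
      "\<bar>(S (h n) f x - f x) / h n - b x\<bar> \<le> (c + d) / \<kappa> x"
      unfolding add_divide_distrib by linarith+
  next
    fix y
    show "((\<lambda>p. (S (h (fst p)) f (snd p) - f (snd p)) / h (fst p) - b (snd p)) \<longlongrightarrow> 0) (sequentially \<times>\<^sub>F nhds y)"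
      by (rule mixed_converges_tendsto[OF conv])
  qed
qed

text \<open>
  Since \<open>S h (S s f) = S s (S h f) = S s (f + h q)\<close> with \<open>q \<rightarrow> b\<close>, convexity bounds the
  difference quotient at scale \<open>h\<close> by the one at the larger scale \<open>\<epsilon>\<close>, where \<open>q\<close> can be
  replaced by its limit because \<open>S s\<close> is continuous.
\<close>

lemma upper_Gamma_generator_orbit_le:
  assumes gen: "(f, b) \<in> generator \<kappa> S" and "0 \<le> s" "0 < \<epsilon>"
  shows "upper_Gamma_generator S (S s f) y \<le> ereal ((S s (\<lambda>x. f x + \<epsilon> * b x) y - S s f y) / \<epsilon>)"
  unfolding upper_Gamma_generator_def
proof (rule Gamma_limsup_within_le)
  fix h :: "nat \<Rightarrow> real" and xs :: "nat \<Rightarrow> 'a"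
  assume "\<And>n. h n \<in> {0<..}" and h0: "h \<longlonglongrightarrow> 0" and xs: "xs \<longlonglongrightarrow> y"
  then have h: "\<And>n. 0 < h n" by auto
  define q where "q n x = (S (h n) f x - f x) / h n" for n x
  obtain c where f: "f \<in> C_kappa \<kappa>" and b: "b \<in> C_kappa \<kappa>" and q: "\<And>n. q n \<in> C_kappa \<kappa>"
    and c: "\<And>n x. \<bar>q n x - b x\<bar> \<le> c / \<kappa> x"
    and lim: "\<And>y. ((\<lambda>p. q (fst p) (snd p) - b (snd p)) \<longlongrightarrow> 0) (sequentially \<times>\<^sub>F nhds y)"
    by (rule generator_sequence[OF gen h h0, folded q_def]) (rule that; assumption)
  interpret R: convex_monotone_operator \<kappa> "S s"
    by (rule operator[OF \<open>0 \<le> s\<close>])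
  define W where "W n = (S s (\<lambda>x. f x + \<epsilon> * q n x) (xs n) - S s f (xs n)) / \<epsilon>" for n
  have "(\<lambda>n. S s (\<lambda>x. f x + \<epsilon> * q n x) (xs n)) \<longlonglongrightarrow> S s (\<lambda>x. f x + \<epsilon> * b x) y"
  proof (rule R.continuous_convergence[OF _ _ _ _ xs])
    show "\<bar>f x + \<epsilon> * q n x - (f x + \<epsilon> * b x)\<bar> \<le> \<epsilon> * c / \<kappa> x" for n x
    proof -
      have "\<bar>f x + \<epsilon> * q n x - (f x + \<epsilon> * b x)\<bar> = \<epsilon> * \<bar>q n x - b x\<bar>"
        using \<open>0 < \<epsilon>\<close> by (simp add: abs_mult flip: right_diff_distrib)
      also have "\<dots> \<le> \<epsilon> * (c / \<kappa> x)"
        using c \<open>0 < \<epsilon>\<close> by (intro mult_left_mono) auto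
      finally show ?thesis by simp
    qed
    show "((\<lambda>p. f (snd p) + \<epsilon> * q (fst p) (snd p) - (f (snd p) + \<epsilon> * b (snd p))) \<longlongrightarrow> 0)
        (sequentially \<times>\<^sub>F nhds z)" for z
      using tendsto_mult_right_zero[OF lim, of \<epsilon> z] by (simp add: right_diff_distrib)
  qed (intro C_kappa_intros f b q)+
  moreover have "(\<lambda>n. S s f (xs n)) \<longlonglongrightarrow> S s f y"
    by (intro C_kappa_tendsto R.maps_to f xs)
  ultimately have W: "W \<longlonglongrightarrow> (S s (\<lambda>x. f x + \<epsilon> * b x) y - S s f y) / \<epsilon>"
    unfolding W_def using \<open>0 < \<epsilon>\<close> by (intro tendsto_intros) auto
  have "\<forall>\<^sub>F n in sequentially. h n < \<epsilon>"
    using order_tendstoD(2)[OF h0 \<open>0 < \<epsilon>\<close>] .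
  then have "\<forall>\<^sub>F n in sequentially. (S (h n) (S s f) (xs n) - S s f (xs n)) / h n \<le> W n"
  proof eventually_elim
    case (elim n)
    have "S (h n) (S s f) = S s (S (h n) f)"
      using semigroup[of "h n" s f] semigroup[of s "h n" f] h[of n] \<open>0 \<le> s\<close> f by (simp add: add.commute)
    moreover have "S (h n) f = (\<lambda>x. f x + h n * q n x)"
      using h[of n] by (simp add: q_def)
    ultimately show ?case
      using R.difference_quotient_mono[OF f q, of "h n" \<epsilon> n "xs n"] h[of n] elim by (simp add: W_def)
  qed
  then have "limsup (\<lambda>n. ereal ((S (h n) (S s f) (xs n) - S s f (xs n)) / h n)) \<le> limsup (\<lambda>n. ereal (W n))"
    by (intro Limsup_mono) simp
  also have "\<dots> = ereal ((S s (\<lambda>x. f x + \<epsilon> * b x) y - S s f y) / \<epsilon>)"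
    using W by (intro lim_imp_Limsup) auto
  finally show "limsup (\<lambda>n. ereal ((S (h n) (S s f) (xs n) - S s f (xs n)) / h n))
      \<le> ereal ((S s (\<lambda>x. f x + \<epsilon> * b x) y - S s f y) / \<epsilon>)" .
qed

end

section \<open>Infinitesimal comparison of two semigroups\<close>

locale semigroup_pair =
  weight \<kappa> + S: weighted_semigroup \<kappa> S + T: weighted_semigroup \<kappa> T
  for \<kappa> :: "'a::polish_space \<Rightarrow> real" and S T
begin

lemma comp_operator: "convex_monotone_operator \<kappa> (\<lambda>f. S r (T s f))" if "0 \<le> r" "0 \<le> s"
  using S.operator[OF that(1)] T.operator[OF that(2)]
  by (rule convex_monotone_operator_comp) (rule T.continuous_from_above[OF that(2)])

text \<open>
  A continuous upper bound \<open>w\<close> of the upper \<open>\<Gamma>\<close>-generator at \<open>g\<close> yields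
  \<open>S h g \<le> g + h (w + \<theta>)\<close> with a globally defined error, to which the monotone operators \<open>S r\<close>
  can be applied.
\<close>

lemma infinitesimal_majorant:
  assumes g: "g \<in> upper_lipschitz_set \<kappa> S" and w: "w \<in> C_kappa \<kappa>"
    and le: "\<And>y. upper_Gamma_generator S g y \<le> ereal (w y)"
    and h: "\<And>n. 0 < h n" "h \<longlonglongrightarrow> 0"
  obtains \<theta> where "\<And>n. \<theta> n \<in> C_kappa \<kappa>" "\<And>n y. 0 \<le> \<theta> n y" "decreases_to_0 \<theta>"
    "\<forall>\<^sub>F n in sequentially. \<forall>y. S (h n) g y \<le> g y + h n * (w y + \<theta> n y)"
proof -
  obtain C \<delta> where C: "0 \<le> C" "0 < \<delta>" "\<And>h x. 0 < h \<Longrightarrow> h < \<delta> \<Longrightarrow> S h g x \<le> g x + C * h / \<kappa> x"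
    using S.upper_lipschitz_setE[OF g] by blast
  obtain d where d: "0 \<le> d" "\<And>x. \<bar>w x\<bar> \<le> d / \<kappa> x"
    using w by (rule C_kappaE) blast
  \<comment> \<open>The upper Lipschitz bound holds for times below \<open>\<delta>\<close>, which \<open>h n\<close> eventually is.\<close>
  define a where "a n y = (if h n < \<delta> then (S (h n) g y - g y) / h n - w y else 0)" for n y
  have bound: "a n y \<le> (C + d) / \<kappa> y" for n y
  proof (cases "h n < \<delta>")
    case True
    have "S (h n) g y - g y \<le> C / \<kappa> y * h n"
      using C(3)[OF h(1) True, of y] by simp
    then have "(S (h n) g y - g y) / h n \<le> C / \<kappa> y"
      using h(1)[of n] by (simp add: pos_divide_le_eq)
    moreover have "- w y \<le> d / \<kappa> y"
      using d(2)[of y] by linarith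
    ultimately show ?thesis
      using True by (simp add: a_def add_divide_distrib)
  next
    case False
    then show ?thesis
      using C(1) d(1) weight_pos[of y] by (simp add: a_def)
  qed
  have lim: "\<forall>\<^sub>F p in sequentially \<times>\<^sub>F nhds y. a (fst p) (snd p) < \<eta>" if "0 < \<eta>" for y \<eta>
  proof (rule eventually_sequentially_nhdsI)
    fix m :: "nat \<Rightarrow> nat" and z assume m: "\<And>k. k \<le> m k" and z: "z \<longlonglongrightarrow> y"
    have "filterlim m at_top sequentially"
      using m by (intro filterlim_at_top_mono[OF filterlim_ident]) (auto intro: always_eventually)
    then have hm: "(\<lambda>k. h (m k)) \<longlonglongrightarrow> 0"
      by (rule filterlim_compose[OF h(2)])
    have "limsup (\<lambda>k. ereal ((S (h (m k)) g (z k) - g (z k)) / h (m k))) \<le> upper_Gamma_generator S g y"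
      unfolding upper_Gamma_generator_def
      using h(1) by (intro limsup_le_Gamma_limsup_within[OF _ hm z]) auto
    also have "\<dots> \<le> ereal (w y)"
      by (rule le)
    also have "\<dots> < ereal (w y + \<eta> / 2)"
      using that by simp
    finally have "\<forall>\<^sub>F k in sequentially. ereal ((S (h (m k)) g (z k) - g (z k)) / h (m k)) < ereal (w y + \<eta> / 2)"
      by (rule Limsup_lessD)
    moreover have "\<forall>\<^sub>F k in sequentially. w y - \<eta> / 2 < w (z k)"
      using that by (intro order_tendstoD(1)[OF C_kappa_tendsto[OF w z]]) auto
    ultimately have "\<forall>\<^sub>F k in sequentially. a (m k) (z k) < \<eta>"
      by eventually_elim (use that in \<open>auto simp: a_def\<close>)
    then show "\<exists>k. a (m k) (z k) < \<eta>"
      unfolding eventually_sequentially by blast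
  qed
  show thesis
  proof (rule C_kappa_majorant[OF bound lim])
    fix \<theta> :: "nat \<Rightarrow> 'a \<Rightarrow> real"
    assume \<theta>: "\<And>n. \<theta> n \<in> C_kappa \<kappa>" "\<And>n y. 0 \<le> \<theta> n y" "\<And>n y. a n y \<le> \<theta> n y" "decreases_to_0 \<theta>"
    have "\<forall>\<^sub>F n in sequentially. h n < \<delta>"
      using order_tendstoD(2)[OF h(2) C(2)] .
    then have "\<forall>\<^sub>F n in sequentially. \<forall>y. S (h n) g y \<le> g y + h n * (w y + \<theta> n y)"
    proof eventually_elim
      case (elim n)
      show ?case
      proof
        fix y
        have "(S (h n) g y - g y) / h n \<le> w y + \<theta> n y"
          using \<theta>(3)[of n y] elim by (simp add: a_def)
        then show "S (h n) g y \<le> g y + h n * (w y + \<theta> n y)"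
          using h(1)[of n] by (simp add: pos_divide_le_eq mult.commute)
      qed
    qed
    with \<theta>(1,2,4) show thesis by (rule that)
  qed
qed

text \<open>
  Enlarging the scale from \<open>h\<close> to the fixed \<open>\<epsilon>\<close> by convexity makes the direction
  \<open>w + \<theta>\<close> enter with a factor that does not vanish, so that \<open>\<theta> \<down> 0\<close> can be exploited.
\<close>

lemma infinitesimal_upper:
  assumes g: "g \<in> upper_lipschitz_set \<kappa> S" and w: "w \<in> C_kappa \<kappa>"
    and le: "\<And>y. upper_Gamma_generator S g y \<le> ereal (w y)"
    and h: "\<And>n. 0 < h n" "h \<longlonglongrightarrow> 0" and "0 \<le> r" "0 < \<epsilon>" "0 < \<eta>"
  shows "\<forall>\<^sub>F n in sequentially.
    S r (S (h n) g) x - S r g x \<le> h n * ((S r (\<lambda>y. g y + \<epsilon> * w y) x - S r g x) / \<epsilon> + \<eta>)"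
proof -
  interpret P: convex_monotone_operator \<kappa> "S r"
    by (rule S.operator[OF \<open>0 \<le> r\<close>])
  have gC: "g \<in> C_kappa \<kappa>"
    using g by (simp add: upper_lipschitz_set_def)
  obtain \<theta> where \<theta>: "\<And>n. \<theta> n \<in> C_kappa \<kappa>" "\<And>n y. 0 \<le> \<theta> n y" "decreases_to_0 \<theta>"
    "\<forall>\<^sub>F n in sequentially. \<forall>y. S (h n) g y \<le> g y + h n * (w y + \<theta> n y)"
    using infinitesimal_majorant[OF g w le h] by blast
  have "(\<lambda>n. S r (\<lambda>y. (g y + \<epsilon> * w y) + \<epsilon> * \<theta> n y) x) \<longlonglongrightarrow> S r (\<lambda>y. g y + \<epsilon> * w y) x"
  proof (rule P.continuous_from_above_at)
    show "decreases_to_0 (\<lambda>n y. \<epsilon> * \<theta> n y)"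
    proof -
      have "decseq (\<lambda>n y. \<epsilon> * \<theta> n y)"
        using \<theta>(3) \<open>0 < \<epsilon>\<close> unfolding decreases_to_0_def
        by (intro antimonoI le_funI mult_left_mono) (auto dest: antimonoD le_funD)
      moreover have "(\<lambda>n. \<epsilon> * \<theta> n y) \<longlonglongrightarrow> 0" for y
        using \<theta>(3) unfolding decreases_to_0_def by (intro tendsto_mult_right_zero) auto
      ultimately show ?thesis
        unfolding decreases_to_0_def by blast
    qed
    show "0 \<le> \<epsilon> * \<theta> n y" for n y
      using \<theta>(2) \<open>0 < \<epsilon>\<close> by simp
  qed (intro C_kappa_intros gC w \<theta>(1))+
  then have "\<forall>\<^sub>F n in sequentially.
      S r (\<lambda>y. (g y + \<epsilon> * w y) + \<epsilon> * \<theta> n y) x < S r (\<lambda>y. g y + \<epsilon> * w y) x + \<epsilon> * \<eta>"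
    using \<open>0 < \<epsilon>\<close> \<open>0 < \<eta>\<close> by (intro order_tendstoD(2)) auto
  moreover have "\<forall>\<^sub>F n in sequentially. h n < \<epsilon>"
    using order_tendstoD(2)[OF h(2) \<open>0 < \<epsilon>\<close>] .
  ultimately show ?thesis
    using \<theta>(4)
  proof eventually_elim
    case (elim n)
    let ?v = "\<lambda>y. w y + \<theta> n y"
    have v: "?v \<in> C_kappa \<kappa>"
      by (intro C_kappa_intros w \<theta>)
    have "S r (S (h n) g) x \<le> S r (\<lambda>y. g y + h n * ?v y) x"
      using elim(3) h(1)[of n] by (intro P.monotone S.maps_to C_kappa_intros gC w \<theta>) auto
    then have "(S r (S (h n) g) x - S r g x) / h n \<le> (S r (\<lambda>y. g y + h n * ?v y) x - S r g x) / h n"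
      using h(1)[of n] by (simp add: divide_right_mono)
    also have "\<dots> \<le> (S r (\<lambda>y. g y + \<epsilon> * ?v y) x - S r g x) / \<epsilon>"
      using elim(2) by (intro P.difference_quotient_mono gC v h) simp
    also have "\<dots> \<le> (S r (\<lambda>y. g y + \<epsilon> * w y) x + \<epsilon> * \<eta> - S r g x) / \<epsilon>"
      using elim(1) \<open>0 < \<epsilon>\<close> by (intro divide_right_mono) (simp_all add: algebra_simps)
    also have "\<dots> = (S r (\<lambda>y. g y + \<epsilon> * w y) x - S r g x) / \<epsilon> + \<eta>"
      using \<open>0 < \<epsilon>\<close> by (simp add: field_simps)
    finally show ?case
      using h(1)[of n] by (simp add: pos_divide_le_eq mult.commute)
  qed
qed

text \<open>
  The function \<open>p = T h f\<close> equals \<open>f + h q\<close> with \<open>q \<rightarrow> b\<close>.  The function \<open>f + h b\<close> lies on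
  the segment from \<open>p\<close> to \<open>p - (q - b)\<close>, at relative distance \<open>h\<close> from \<open>p\<close>.  By convexity,
  replacing \<open>p\<close> by \<open>f + h b\<close> raises the value by at most \<open>h\<close> times the difference of the values at these
  endpoints, and this difference vanishes because both endpoints converge to \<open>f\<close>.
\<close>

lemma infinitesimal_lower:
  assumes gen: "(f, b) \<in> generator \<kappa> T" and h: "\<And>n. 0 < h n" "h \<longlonglongrightarrow> 0"
    and "0 \<le> r" "0 \<le> s" "0 < \<eta>"
  shows "\<forall>\<^sub>F n in sequentially. h n * ((S r (T s (\<lambda>y. f y + h n * b y)) x - S r (T s f) x) / h n - \<eta>)
    \<le> S r (T (h n) (T s f)) x - S r (T s f) x"
proof -
  let ?R = "\<lambda>f. S r (T s f)"
  interpret R: convex_monotone_operator \<kappa> ?R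
    by (rule comp_operator[OF \<open>0 \<le> r\<close> \<open>0 \<le> s\<close>])
  define q where "q n x = (T (h n) f x - f x) / h n" for n x
  obtain c where f: "f \<in> C_kappa \<kappa>" and b: "b \<in> C_kappa \<kappa>" and q: "\<And>n. q n \<in> C_kappa \<kappa>"
    and c: "\<And>n x. \<bar>q n x\<bar> \<le> c / \<kappa> x" "\<And>n x. \<bar>q n x - b x\<bar> \<le> c / \<kappa> x"
    and lim: "\<And>y. ((\<lambda>p. q (fst p) (snd p) - b (snd p)) \<longlongrightarrow> 0) (sequentially \<times>\<^sub>F nhds y)"
    by (rule T.generator_sequence[OF gen h, folded q_def]) (rule that; assumption)
  define p where "p n x = f x + h n * q n x" for n x
  have p: "p n \<in> C_kappa \<kappa>" for n
    unfolding p_def by (intro C_kappa_intros f q)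
  have p_eq: "T (h n) f = p n" for n
    using h(1)[of n] by (simp add: p_def q_def fun_eq_iff)
  obtain H where H: "\<And>n. h n \<le> H"
    using convergent_imp_Bseq[OF convergentI[OF h(2)]] unfolding Bseq_def
    by (metis abs_le_D1 real_norm_def)
  have Hc: "\<bar>h n * q n y\<bar> \<le> H * (c / \<kappa> y)" for n y
    unfolding abs_mult using H[of n] h(1)[of n] c(1)[of n y] by (intro mult_mono) auto
  have hq: "((\<lambda>p. h (fst p) * q (fst p) (snd p)) \<longlongrightarrow> 0) (sequentially \<times>\<^sub>F nhds y)" for y
  proof -
    have "((\<lambda>p. h (fst p)) \<longlongrightarrow> 0) (sequentially \<times>\<^sub>F nhds y)"
      by (rule filterlim_compose[OF h(2) filterlim_fst])
    moreover have "((\<lambda>p. b (snd p)) \<longlongrightarrow> b y) (sequentially \<times>\<^sub>F nhds y)"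
      by (intro C_kappa_tendsto b filterlim_snd)
    ultimately have "((\<lambda>p. h (fst p) * (q (fst p) (snd p) - b (snd p) + b (snd p))) \<longlongrightarrow> 0 * (0 + b y))
        (sequentially \<times>\<^sub>F nhds y)"
      by (intro tendsto_intros lim)
    then show ?thesis by simp
  qed
  have 1: "(\<lambda>n. ?R (p n) x) \<longlonglongrightarrow> ?R f x"
  proof (rule R.continuous_convergence[OF f p])
    show "\<bar>p n y - f y\<bar> \<le> (H * c) / \<kappa> y" for n y
      using Hc[of n y] by (simp add: p_def)
    show "((\<lambda>z. p (fst z) (snd z) - f (snd z)) \<longlongrightarrow> 0) (sequentially \<times>\<^sub>F nhds y)" for y
      using hq by (simp add: p_def)
  qed simp
  have 2: "(\<lambda>n. ?R (\<lambda>y. p n y - (q n y - b y)) x) \<longlonglongrightarrow> ?R f x"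
  proof (rule R.continuous_convergence[OF f])
    show "\<bar>p n y - (q n y - b y) - f y\<bar> \<le> (H * c + c) / \<kappa> y" for n y
      using Hc[of n y] c(2)[of n y] by (simp add: p_def add_divide_distrib)
    show "((\<lambda>z. p (fst z) (snd z) - (q (fst z) (snd z) - b (snd z)) - f (snd z)) \<longlongrightarrow> 0)
        (sequentially \<times>\<^sub>F nhds y)" for y
      using tendsto_diff[OF hq lim, of y] by (simp add: p_def algebra_simps)
    show "(\<lambda>y. p n y - (q n y - b y)) \<in> C_kappa \<kappa>" for n
      by (intro C_kappa_intros p q b)
  qed simp
  have "(\<lambda>n. ?R (\<lambda>y. p n y - (q n y - b y)) x - ?R (p n) x) \<longlonglongrightarrow> 0"
    using tendsto_diff[OF 2 1] by simp
  then have "\<forall>\<^sub>F n in sequentially. ?R (\<lambda>y. p n y - (q n y - b y)) x - ?R (p n) x < \<eta>"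
    using \<open>0 < \<eta>\<close> by (rule order_tendstoD(2))
  moreover have "\<forall>\<^sub>F n in sequentially. h n < 1"
    using order_tendstoD(2)[OF h(2), of 1] by simp
  ultimately show ?thesis
  proof eventually_elim
    case (elim n)
    have "?R (\<lambda>y. p n y + h n * ((p n y - (q n y - b y)) - p n y)) x - ?R (p n) x
        \<le> h n * (?R (\<lambda>y. p n y - (q n y - b y)) x - ?R (p n) x)"
      using h(1)[of n] elim(2) by (intro R.convex_diff C_kappa_intros p q b) auto
    also have "\<dots> \<le> h n * \<eta>"
      using elim(1) h(1)[of n] by (intro mult_left_mono) auto
    also have "(\<lambda>y. p n y + h n * ((p n y - (q n y - b y)) - p n y)) = (\<lambda>y. f y + h n * b y)"
      by (simp add: p_def fun_eq_iff algebra_simps)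
    finally have "?R (\<lambda>y. f y + h n * b y) x - ?R (p n) x \<le> h n * \<eta>" .
    moreover have "T (h n) (T s f) = T s (p n)"
      using T.semigroup[of "h n" s f] T.semigroup[of s "h n" f] h(1)[of n] \<open>0 \<le> s\<close> f
      by (simp add: add.commute p_eq)
    ultimately show ?case
      using h(1)[of n] by (simp add: right_diff_distrib[of "h n" _ \<eta>])
  qed
qed

text \<open>
  The difference quotients \<open>Q \<epsilon>\<close> of \<open>S r \<circ> T s\<close> at \<open>f\<close> in direction \<open>b\<close> are monotone in
  \<open>\<epsilon>\<close> and bounded below.  One fixed \<open>\<epsilon>\<close> at which \<open>Q\<close> is nearly minimal therefore serves for the
  upper bound, and \<open>Q h\<close> in the lower bound is at most \<open>\<eta> / 4\<close> smaller than \<open>Q \<epsilon>\<close>.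
\<close>

lemma infinitesimal_comparison:
  assumes gen: "(f, b) \<in> generator \<kappa> T" and lip: "T s f \<in> upper_lipschitz_set \<kappa> S"
    and le: "upper_Gamma_generator S (T s f) \<le> upper_Gamma_generator T (T s f)"
    and h: "\<And>n. 0 < h n" "h \<longlonglongrightarrow> 0" and "0 \<le> r" "0 \<le> s" "0 < \<eta>"
  shows "\<forall>\<^sub>F n in sequentially. S r (S (h n) (T s f)) x - S r (T (h n) (T s f)) x \<le> h n * \<eta>"
proof -
  let ?R = "\<lambda>f. S r (T s f)"
  interpret R: convex_monotone_operator \<kappa> ?R
    by (rule comp_operator[OF \<open>0 \<le> r\<close> \<open>0 \<le> s\<close>])
  have f: "f \<in> C_kappa \<kappa>" and b: "b \<in> C_kappa \<kappa>"
    using gen by (simp_all add: generator_def)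
  define Q where "Q \<epsilon> = (?R (\<lambda>y. f y + \<epsilon> * b y) x - ?R f x) / \<epsilon>" for \<epsilon>
  have Q_lower: "?R f x - ?R (\<lambda>y. f y - b y) x \<le> Q \<epsilon>" if "0 < \<epsilon>" "\<epsilon> \<le> 1" for \<epsilon>
  proof -
    have "(?R (\<lambda>y. f y + \<epsilon> * (- 1 * b y)) x - ?R f x) / \<epsilon> \<le> (?R (\<lambda>y. f y + 1 * (- 1 * b y)) x - ?R f x) / 1"
      using that by (intro R.difference_quotient_mono C_kappa_intros f b)
    then have "?R f x - ?R (\<lambda>y. f y - b y) x \<le> (?R f x - ?R (\<lambda>y. f y - \<epsilon> * b y) x) / \<epsilon>"
      using that by (simp add: field_simps)
    also have "\<dots> \<le> Q \<epsilon>"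
      unfolding Q_def using R.reflect[OF f C_kappa_cmult[OF b], of x \<epsilon>] that
      by (intro divide_right_mono) auto
    finally show ?thesis .
  qed
  then have bdd: "bdd_below (Q ` {0<..1})"
    by (intro bdd_belowI2) auto
  have "Inf (Q ` {0<..1}) < Inf (Q ` {0<..1}) + \<eta> / 4"
    using \<open>0 < \<eta>\<close> by simp
  then obtain \<epsilon> where \<epsilon>: "0 < \<epsilon>" "\<epsilon> \<le> 1" "Q \<epsilon> < Inf (Q ` {0<..1}) + \<eta> / 4"
    using cInf_lessD[of "Q ` {0<..1}"] by force
  have Q_close: "Q \<epsilon> \<le> Q k + \<eta> / 4" if "0 < k" "k \<le> 1" for k
    using cINF_lower[OF bdd, of k] that \<epsilon>(3) by simp
  define w where "w y = (T s (\<lambda>z. f z + \<epsilon> * b z) y - T s f y) / \<epsilon>" for y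
  have w: "w \<in> C_kappa \<kappa>"
    unfolding w_def by (intro C_kappa_intros T.maps_to f b \<open>0 \<le> s\<close>)
  have le_w: "upper_Gamma_generator S (T s f) y \<le> ereal (w y)" for y
    using le T.upper_Gamma_generator_orbit_le[OF gen \<open>0 \<le> s\<close> \<epsilon>(1), of y]
    unfolding w_def le_fun_def by (meson order_trans)
  have w_eq: "(\<lambda>y. T s f y + \<epsilon> * w y) = T s (\<lambda>z. f z + \<epsilon> * b z)"
    using \<epsilon>(1) by (simp add: w_def)
  have \<eta>: "0 < \<eta> / 4"
    using \<open>0 < \<eta>\<close> by simp
  have "\<forall>\<^sub>F n in sequentially. S r (S (h n) (T s f)) x - ?R f x \<le> h n * (Q \<epsilon> + \<eta> / 4)"
    using infinitesimal_upper[OF lip w le_w h \<open>0 \<le> r\<close> \<epsilon>(1) \<eta>, of x] by (simp add: w_eq Q_def)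
  moreover have "\<forall>\<^sub>F n in sequentially. h n * (Q (h n) - \<eta> / 4) \<le> S r (T (h n) (T s f)) x - ?R f x"
    using infinitesimal_lower[OF gen h \<open>0 \<le> r\<close> \<open>0 \<le> s\<close> \<eta>] by (simp add: Q_def)
  moreover have "\<forall>\<^sub>F n in sequentially. h n < 1"
    using order_tendstoD(2)[OF h(2), of 1] by simp
  ultimately show ?thesis
  proof eventually_elim
    case (elim n)
    have "h n * (Q \<epsilon> + \<eta> / 4) - h n * (Q (h n) - \<eta> / 4) = h n * (Q \<epsilon> - Q (h n) + \<eta> / 2)"
      by (simp add: algebra_simps)
    also have "\<dots> \<le> h n * \<eta>"
      using Q_close[of "h n"] h(1)[of n] elim(3) \<open>0 < \<eta>\<close> by (intro mult_left_mono) auto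
    finally show ?case
      using elim(1,2) by linarith
  qed
qed

end

section \<open>Integration over a time window\<close>

text \<open>
  The classical argument for Dini derivatives; semicontinuity from the left lets the supremum of the set of
  good points inherit the inequality, and the right-hand condition moves beyond it.
\<close>

lemma le_of_right_increase:
  fixes I :: "real \<Rightarrow> real"
  assumes "0 \<le> l"
    and right: "\<And>\<tau> \<eta>. 0 \<le> \<tau> \<Longrightarrow> \<tau> < l \<Longrightarrow> 0 < \<eta> \<Longrightarrow> \<exists>h>0. \<tau> + h \<le> l \<and> I \<tau> \<le> I (\<tau> + h) + \<eta> * h"
    and left: "\<And>\<tau> \<eta>. 0 < \<tau> \<Longrightarrow> \<tau> \<le> l \<Longrightarrow> 0 < \<eta> \<Longrightarrow>
      \<exists>\<delta>>0. \<forall>\<sigma>. 0 \<le> \<sigma> \<and> \<tau> - \<delta> < \<sigma> \<and> \<sigma> < \<tau> \<longrightarrow> I \<sigma> \<le> I \<tau> + \<eta>"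
  shows "I 0 \<le> I l"
proof -
  have main: "I 0 \<le> I l + \<eta> * l" if "0 < \<eta>" for \<eta>
  proof -
    define A where "A = {\<tau>. 0 \<le> \<tau> \<and> \<tau> \<le> l \<and> I 0 \<le> I \<tau> + \<eta> * \<tau>}"
    define s where "s = Sup A"
    have A0: "0 \<in> A" and bdd: "bdd_above A"
      using \<open>0 \<le> l\<close> by (auto simp: A_def)
    have "0 \<le> s"
      unfolding s_def using A0 bdd by (rule cSup_upper)
    moreover have "s \<le> l"
      unfolding s_def using A0 by (intro cSup_least) (auto simp: A_def)
    ultimately have s: "0 \<le> s" "s \<le> l" .
    have "I 0 \<le> I s + \<eta> * s"
    proof (cases "s = 0")
      case False
      show ?thesis
      proof (rule field_le_epsilon)
        fix \<epsilon> :: real assume "0 < \<epsilon>"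
        then obtain \<delta> where \<delta>: "0 < \<delta>" "\<And>\<sigma>. 0 \<le> \<sigma> \<Longrightarrow> s - \<delta> < \<sigma> \<Longrightarrow> \<sigma> < s \<Longrightarrow> I \<sigma> \<le> I s + \<epsilon>"
          using left[of s \<epsilon>] s False by auto
        have "s - \<delta> < Sup A"
          using \<delta> by (simp add: s_def)
        then obtain \<sigma> where \<sigma>: "\<sigma> \<in> A" "s - \<delta> < \<sigma>"
          using less_cSup_iff[of A "s - \<delta>"] A0 bdd by blast
        have "\<sigma> \<le> s"
          using \<sigma>(1) bdd by (simp add: s_def cSup_upper)
        have "I \<sigma> \<le> I s + \<epsilon>"
          using \<delta>(2)[of \<sigma>] \<sigma> \<open>\<sigma> \<le> s\<close> \<open>0 < \<epsilon>\<close> by (cases "\<sigma> = s") (auto simp: A_def)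
        moreover have "\<eta> * \<sigma> \<le> \<eta> * s"
          using \<open>\<sigma> \<le> s\<close> that by simp
        ultimately show "I 0 \<le> I s + \<eta> * s + \<epsilon>"
          using \<sigma>(1) by (simp add: A_def)
      qed
    qed simp
    moreover have "s = l"
    proof (rule ccontr)
      assume "s \<noteq> l"
      then obtain h where h: "0 < h" "s + h \<le> l" "I s \<le> I (s + h) + \<eta> * h"
        using right[of s \<eta>] s \<open>0 < \<eta>\<close> by auto
      with \<open>I 0 \<le> I s + \<eta> * s\<close> s have "s + h \<in> A"
        by (simp add: A_def distrib_left)
      then have "s + h \<le> s"
        unfolding s_def using bdd by (rule cSup_upper)
      with h(1) show False by simp
    qed
    ultimately show ?thesis by simp
  qed
  show ?thesis
  proof (rule field_le_epsilon)
    fix \<epsilon> :: real assume "0 < \<epsilon>"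
    with main[of "\<epsilon> / (l + 1)"] \<open>0 \<le> l\<close> have "I 0 \<le> I l + \<epsilon> / (l + 1) * l"
      by simp
    also have "\<dots> \<le> I l + \<epsilon>"
      using \<open>0 < \<epsilon>\<close> \<open>0 \<le> l\<close> by (simp add: field_simps)
    finally show "I 0 \<le> I l + \<epsilon>" .
  qed
qed

context weighted_semigroup
begin

text \<open>
  The estimate at time \<open>0\<close> propagates along the orbit because \<open>S r\<close> is Lipschitz on bounded
  sets, locally uniformly in \<open>r\<close>.  The bound \<open>1 / (C + 1)\<close> on \<open>h\<close> ensures that the perturbation
  \<open>C h\<close> is at most \<open>1\<close>.
\<close>

lemma upper_lipschitz_time:
  assumes "f \<in> upper_lipschitz_set \<kappa> S" "0 \<le> t"
  obtains c \<delta> where "0 \<le> c" "0 < \<delta>"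
    "\<And>r h x. \<lbrakk>0 \<le> r; r \<le> t; 0 < h; h < \<delta>\<rbrakk> \<Longrightarrow> S (r + h) f x \<le> S r f x + c * h / \<kappa> x"
proof -
  have f: "f \<in> C_kappa \<kappa>"
    using assms(1) by (simp add: upper_lipschitz_set_def)
  then obtain d where d: "0 \<le> d" "\<And>x. \<bar>f x\<bar> \<le> d / \<kappa> x"
    by (rule C_kappaE) blast
  obtain C \<delta> where C: "0 \<le> C" "0 < \<delta>" "\<And>h x. 0 < h \<Longrightarrow> h < \<delta> \<Longrightarrow> S h f x \<le> f x + C * h / \<kappa> x"
    using upper_lipschitz_setE[OF assms(1)] by blast
  obtain L where L: "0 \<le> L" "\<And>r f g \<epsilon> x. \<lbrakk>0 \<le> r; r \<le> t; f \<in> C_kappa \<kappa>; g \<in> C_kappa \<kappa>; \<And>y. \<bar>f y\<bar> \<le> d / \<kappa> y;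
    0 \<le> \<epsilon>; \<epsilon> \<le> 1; \<And>y. g y \<le> f y + \<epsilon> / \<kappa> y\<rbrakk> \<Longrightarrow> S r g x \<le> S r f x + L * \<epsilon> / \<kappa> x"
    using locally_uniform_perturbation[OF d(1) assms(2)] by blast
  show thesis
  proof (rule that[of "L * C" "min \<delta> (1 / (C + 1))"])
    fix r h x assume rh: "0 \<le> r" "r \<le> t" "0 < h" "h < min \<delta> (1 / (C + 1))"
    then have "h * (C + 1) < 1"
      using C(1) by (simp add: field_simps)
    then have "C * h \<le> 1"
      using rh(3) by (simp add: algebra_simps)
    then have "S r (S h f) x \<le> S r f x + L * (C * h) / \<kappa> x"
      using rh C(1) d C(3) by (intro L(2) f maps_to) auto
    then show "S (r + h) f x \<le> S r f x + L * C * h / \<kappa> x"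
      using semigroup[of r h f] rh f by (simp add: mult.assoc)
  qed (use C L in auto)
qed

lemma lipschitz_time:
  assumes "f \<in> lipschitz_set \<kappa> S" "0 \<le> t"
  obtains c \<delta> where "0 \<le> c" "0 < \<delta>"
    "\<And>r h x. \<lbrakk>0 \<le> r; 0 < h; h < \<delta>; r + h \<le> t\<rbrakk> \<Longrightarrow> S r f x \<le> S (r + h) f x + c * h / \<kappa> x"
proof -
  have f: "f \<in> C_kappa \<kappa>"
    using assms(1) by (simp add: lipschitz_set_def)
  obtain M where M: "0 \<le> M" "\<And>r x. 0 \<le> r \<Longrightarrow> r \<le> t \<Longrightarrow> \<bar>S r f x\<bar> \<le> M / \<kappa> x"
    using locally_bounded_orbit[OF f assms(2)] by blast
  obtain C \<delta> where C: "0 \<le> C" "0 < \<delta>" "\<And>h x. 0 < h \<Longrightarrow> h < \<delta> \<Longrightarrow> f x \<le> S h f x + C * h / \<kappa> x"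
    using lipschitz_setE[OF assms(1)] by blast
  obtain L where L: "0 \<le> L" "\<And>r f g \<epsilon> x. \<lbrakk>0 \<le> r; r \<le> t; f \<in> C_kappa \<kappa>; g \<in> C_kappa \<kappa>; \<And>y. \<bar>f y\<bar> \<le> M / \<kappa> y;
    0 \<le> \<epsilon>; \<epsilon> \<le> 1; \<And>y. g y \<le> f y + \<epsilon> / \<kappa> y\<rbrakk> \<Longrightarrow> S r g x \<le> S r f x + L * \<epsilon> / \<kappa> x"
    using locally_uniform_perturbation[OF M(1) assms(2)] by blast
  show thesis
  proof (rule that[of "L * C" "min \<delta> (1 / (C + 1))"])
    fix r h x assume rh: "0 \<le> r" "0 < h" "h < min \<delta> (1 / (C + 1))" "r + h \<le> t"
    then have "h * (C + 1) < 1"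
      using C(1) by (simp add: field_simps)
    then have "C * h \<le> 1"
      using rh(2) by (simp add: algebra_simps)
    then have "S r f x \<le> S r (S h f) x + L * (C * h) / \<kappa> x"
      using rh C(1) M(2)[of h] C(3) by (intro L(2) f maps_to) auto
    then show "S r f x \<le> S (r + h) f x + L * C * h / \<kappa> x"
      using semigroup[of r h f] rh f by (simp add: mult.assoc)
  qed (use C L in auto)
qed

lemma upper_semicontinuous_at_0:
  assumes "f \<in> C_kappa \<kappa>" "0 < \<epsilon>"
  obtains \<delta> where "0 < \<delta>" "\<And>r. 0 \<le> r \<Longrightarrow> r < \<delta> \<Longrightarrow> S r f x \<le> f x + \<epsilon>"
proof -
  have "\<exists>\<delta>>0. \<forall>r. 0 \<le> r \<and> r < \<delta> \<longrightarrow> S r f x \<le> f x + \<epsilon>"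
  proof (rule ccontr)
    assume "\<not> ?thesis"
    then have "\<exists>r. 0 \<le> r \<and> r < \<delta> \<and> f x + \<epsilon> < S r f x" if "0 < \<delta>" for \<delta>
      using that by (meson not_le)
    then have "\<exists>r. 0 \<le> r \<and> r < inverse (real (Suc n)) \<and> f x + \<epsilon> < S r f x" for n
      by simp
    then obtain r where r: "\<And>n. 0 \<le> r n" "\<And>n. r n < inverse (real (Suc n))" "\<And>n. f x + \<epsilon> < S (r n) f x"
      by metis
    have "r \<longlonglongrightarrow> 0"
      by (rule tendsto_sandwich[OF _ _ tendsto_const LIMSEQ_inverse_real_of_nat])
        (use r in \<open>auto intro!: always_eventually less_imp_le\<close>)
    then have "limsup (\<lambda>n. ereal (S (r n) f x)) \<le> ereal (f x)"
      using limsup_time[OF assms(1), of r 0 x] r(1) at_0[OF assms(1)] by simp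
    moreover have "ereal (f x + \<epsilon>) \<le> limsup (\<lambda>n. ereal (S (r n) f x))"
      using r(3) by (intro le_Limsup always_eventually) (auto intro: less_imp_le)
    ultimately have "ereal (f x + \<epsilon>) \<le> ereal (f x)"
      by (rule order_trans[rotated])
    then show False
      using assms(2) by simp
  qed
  then show thesis
    using that by blast
qed

end

section \<open>Comparison along the orbit\<close>

locale semigroup_comparison = semigroup_pair \<kappa> S T
  for \<kappa> :: "'a::polish_space \<Rightarrow> real" and S T +
  fixes D :: "('a \<Rightarrow> real) set"
  assumes D_subset: "D \<subseteq> lipschitz_set \<kappa> T \<inter> upper_lipschitz_set \<kappa> S"
    and D_invariant: "0 \<le> t \<Longrightarrow> f \<in> D \<Longrightarrow> T t f \<in> D"
    and generator_le: "f \<in> D \<Longrightarrow> upper_Gamma_generator S f \<le> upper_Gamma_generator T f"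
begin

lemma D_C_kappa: "f \<in> D \<Longrightarrow> f \<in> C_kappa \<kappa>"
  using D_subset by (auto simp: lipschitz_set_def)

lemma mixed_lipschitz:
  assumes "f \<in> D" "0 \<le> t"
  obtains c \<delta> where "0 \<le> c" "0 < \<delta>"
    "\<And>r s h x. \<lbrakk>0 \<le> r; r \<le> t; 0 \<le> s; 0 < h; h < \<delta>; s + h \<le> t\<rbrakk> \<Longrightarrow>
      S r (T s f) x \<le> S r (T (s + h) f) x + c * h / \<kappa> x"
proof -
  have f: "f \<in> C_kappa \<kappa>"
    using assms(1) by (rule D_C_kappa)
  obtain M where M: "0 \<le> M" "\<And>r x. 0 \<le> r \<Longrightarrow> r \<le> t \<Longrightarrow> \<bar>T r f x\<bar> \<le> M / \<kappa> x"
    using T.locally_bounded_orbit[OF f assms(2)] by blast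
  have "f \<in> lipschitz_set \<kappa> T"
    using assms(1) D_subset by blast
  then obtain C \<delta> where C: "0 \<le> C" "0 < \<delta>"
    "\<And>r h x. \<lbrakk>0 \<le> r; 0 < h; h < \<delta>; r + h \<le> t\<rbrakk> \<Longrightarrow> T r f x \<le> T (r + h) f x + C * h / \<kappa> x"
    using T.lipschitz_time[OF _ assms(2)] by blast
  obtain L where L: "0 \<le> L" "\<And>r f g \<epsilon> x. \<lbrakk>0 \<le> r; r \<le> t; f \<in> C_kappa \<kappa>; g \<in> C_kappa \<kappa>; \<And>y. \<bar>f y\<bar> \<le> M / \<kappa> y;
    0 \<le> \<epsilon>; \<epsilon> \<le> 1; \<And>y. g y \<le> f y + \<epsilon> / \<kappa> y\<rbrakk> \<Longrightarrow> S r g x \<le> S r f x + L * \<epsilon> / \<kappa> x"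
    using S.locally_uniform_perturbation[OF M(1) assms(2)] by blast
  show thesis
  proof (rule that[of "L * C" "min \<delta> (1 / (C + 1))"])
    fix r s h x
    assume rh: "0 \<le> r" "r \<le> t" "0 \<le> s" "0 < h" "h < min \<delta> (1 / (C + 1))" "s + h \<le> t"
    then have "h * (C + 1) < 1"
      using C(1) by (simp add: field_simps)
    then have "C * h \<le> 1"
      using rh(4) by (simp add: algebra_simps)
    then have "S r (T s f) x \<le> S r (T (s + h) f) x + L * (C * h) / \<kappa> x"
      using rh C(1) M(2)[of "s + h"] C(3) by (intro L(2) T.maps_to f) auto
    then show "S r (T s f) x \<le> S r (T (s + h) f) x + L * C * h / \<kappa> x"
      by (simp add: mult.assoc)
  qed (use C L in auto)
qed

text \<open>
  The dominating function for the limit \<open>h \<down> 0\<close>: at a point of \<open>D\<close> both \<open>S h g - g\<close> and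
  \<open>g - T h g\<close> are at most a multiple of \<open>h / \<kappa>\<close>.
\<close>

lemma difference_bound:
  assumes g: "g \<in> D" and "0 \<le> t"
  obtains B \<delta> where "0 \<le> B" "0 < \<delta>"
    "\<And>r h x. \<lbrakk>0 \<le> r; r \<le> t; 0 < h; h < \<delta>\<rbrakk> \<Longrightarrow> S r (S h g) x - S r (T h g) x \<le> h * (B / \<kappa> x)"
proof -
  have gC: "g \<in> C_kappa \<kappa>"
    using g by (rule D_C_kappa)
  obtain M where M: "0 \<le> M" "\<And>r x. 0 \<le> r \<Longrightarrow> r \<le> 1 \<Longrightarrow> \<bar>T r g x\<bar> \<le> M / \<kappa> x"
    using T.locally_bounded_orbit[OF gC, of 1] by auto
  have "g \<in> upper_lipschitz_set \<kappa> S"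
    using g D_subset by blast
  then obtain C1 \<delta>1 where C1: "0 \<le> C1" "0 < \<delta>1"
    "\<And>h x. 0 < h \<Longrightarrow> h < \<delta>1 \<Longrightarrow> S h g x \<le> g x + C1 * h / \<kappa> x"
    using S.upper_lipschitz_setE by blast
  have "g \<in> lipschitz_set \<kappa> T"
    using g D_subset by blast
  then obtain C2 \<delta>2 where C2: "0 \<le> C2" "0 < \<delta>2"
    "\<And>h x. 0 < h \<Longrightarrow> h < \<delta>2 \<Longrightarrow> g x \<le> T h g x + C2 * h / \<kappa> x"
    using T.lipschitz_setE by blast
  obtain L where L: "0 \<le> L" "\<And>r f g \<epsilon> x. \<lbrakk>0 \<le> r; r \<le> t; f \<in> C_kappa \<kappa>; g \<in> C_kappa \<kappa>; \<And>y. \<bar>f y\<bar> \<le> M / \<kappa> y;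
    0 \<le> \<epsilon>; \<epsilon> \<le> 1; \<And>y. g y \<le> f y + \<epsilon> / \<kappa> y\<rbrakk> \<Longrightarrow> S r g x \<le> S r f x + L * \<epsilon> / \<kappa> x"
    using S.locally_uniform_perturbation[OF M(1) assms(2)] by blast
  show thesis
  proof (rule that[of "L * (C1 + C2)" "min (min \<delta>1 \<delta>2) (1 / (C1 + C2 + 1))"])
    fix r h x
    assume rh: "0 \<le> r" "r \<le> t" "0 < h" "h < min (min \<delta>1 \<delta>2) (1 / (C1 + C2 + 1))"
    then have "h * (C1 + C2 + 1) < 1"
      using C1(1) C2(1) by (simp add: field_simps)
    then have small: "(C1 + C2) * h + h < 1"
      by (simp add: algebra_simps)
    have nonneg: "0 \<le> (C1 + C2) * h"
      using C1(1) C2(1) rh(3) by simp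
    have "S r (S h g) x \<le> S r (T h g) x + L * ((C1 + C2) * h) / \<kappa> x"
    proof (rule L(2)[OF rh(1,2)])
      show "S h g y \<le> T h g y + (C1 + C2) * h / \<kappa> y" for y
        using C1(3)[of h y] C2(3)[of h y] rh by (simp add: distrib_right add_divide_distrib)
      show "\<bar>T h g y\<bar> \<le> M / \<kappa> y" for y
        using M(2)[of h] rh small nonneg by simp
    qed (use rh small nonneg gC in \<open>auto intro: S.maps_to T.maps_to\<close>)
    then show "S r (S h g) x - S r (T h g) x \<le> h * (L * (C1 + C2) / \<kappa> x)"
      by (simp add: mult.assoc mult.commute mult.left_commute)
  qed (use C1 C2 L in auto)
qed

text \<open>
  The average (up to the factor \<open>\<eta>\<close>) of \<open>S r (T \<tau> f) x\<close> over elapsed total times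
  \<open>r + \<tau> \<in> [t - \<eta>, t]\<close>.
\<close>

definition window :: "('a \<Rightarrow> real) \<Rightarrow> 'a \<Rightarrow> real \<Rightarrow> real \<Rightarrow> real \<Rightarrow> real" where
  "window f x t \<eta> \<tau> = integral {t - \<tau> - \<eta>..t - \<tau>} (\<lambda>r. S (max r 0) (T \<tau> f) x)"

text \<open>
  With \<open>g = T \<tau> f\<close>, translation by \<open>h\<close> turns \<open>S r g\<close> into \<open>S r (S h g)\<close>, and both windows
  are then integrals over the same interval.  Their difference, divided by \<open>h\<close>, is bounded by the
  integral of the positive part \<open>k\<close> of the quotients in \<open>infinitesimal_comparison\<close>, which tends
  to \<open>0\<close> by dominated convergence.  The positive part is taken because
  the quotients are bounded uniformly in \<open>h\<close> from above, but not from below.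
\<close>

lemma window_right:
  assumes f: "f \<in> D" and gen: "(f, b) \<in> generator \<kappa> T"
    and \<tau>: "0 \<le> \<tau>" "\<tau> < t - \<eta>" "0 < \<eta>" and \<epsilon>: "0 < \<epsilon>"
  shows "\<exists>h>0. \<tau> + h \<le> t - \<eta> \<and> window f x t \<eta> \<tau> \<le> window f x t \<eta> (\<tau> + h) + \<epsilon> * h"
proof -
  define g where "g = T \<tau> f"
  have fC: "f \<in> C_kappa \<kappa>"
    using f by (rule D_C_kappa)
  have gD: "g \<in> D"
    unfolding g_def using \<tau>(1) f by (rule D_invariant)
  have gC: "g \<in> C_kappa \<kappa>"
    using gD by (rule D_C_kappa)
  have t: "0 \<le> t"
    using \<tau> by simp
  obtain B \<delta> where B: "0 \<le> B" "0 < \<delta>"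
    "\<And>r h x. \<lbrakk>0 \<le> r; r \<le> t; 0 < h; h < \<delta>\<rbrakk> \<Longrightarrow> S r (S h g) x - S r (T h g) x \<le> h * (B / \<kappa> x)"
    using difference_bound[OF gD t] by blast
  define d where "d = min (\<delta> / 2) (t - \<eta> - \<tau>)"
  define h where "h n = d * inverse (real (Suc n))" for n
  have d: "0 < d" "d < \<delta>" "\<tau> + d \<le> t - \<eta>"
    using B(2) \<tau> by (auto simp: d_def)
  have h: "0 < h n" for n
    using d by (simp add: h_def)
  have h_le: "h n \<le> d" for n
    using d by (simp add: h_def field_simps)
  have h0: "h \<longlonglongrightarrow> 0"
    unfolding h_def by (intro tendsto_mult_right_zero LIMSEQ_inverse_real_of_nat)
  define k where "k n r = max 0 ((S (max r 0) (S (h n) g) x - S (max r 0) (T (h n) g) x) / h n)" for n r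
  have k_integrable: "k n integrable_on {0..t}" for n
  proof -
    have "(\<lambda>r. (S (max r 0) (S (h n) g) x - S (max r 0) (T (h n) g) x) / h n) absolutely_integrable_on {0..t}"
      using h[of n] gC
      by (intro set_integrable_divide set_integral_diff(1) S.integrable_time S.maps_to T.maps_to) auto
    then have "(\<lambda>r. max 0 ((S (max r 0) (S (h n) g) x - S (max r 0) (T (h n) g) x) / h n))
        absolutely_integrable_on {0..t}"
      by (intro absolutely_integrable_max_1) auto
    then show ?thesis
      unfolding k_def by (rule set_lebesgue_integral_eq_integral(1))
  qed
  have "(\<lambda>n. integral {0..t} (k n)) \<longlonglongrightarrow> integral {0..t} (\<lambda>r. 0)"
  proof (rule dominated_convergence(2)[OF k_integrable integrable_const_ivl])
    show "norm (k n r) \<le> B / \<kappa> x" if "r \<in> {0..t}" for n r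
      using B(3)[of r "h n" x] that h[of n] h_le[of n] d(2) B(1) weight_pos[of x]
      by (simp add: k_def pos_divide_le_eq mult.commute)
    show "(\<lambda>n. k n r) \<longlonglongrightarrow> 0" if "r \<in> {0..t}" for r
    proof (rule tendstoI)
      fix e :: real assume "0 < e"
      then have "0 < e / 2" by simp
      have "\<forall>\<^sub>F n in sequentially. S r (S (h n) (T \<tau> f)) x - S r (T (h n) (T \<tau> f)) x \<le> h n * (e / 2)"
        using that gD D_subset generator_le[OF gD]
        by (intro infinitesimal_comparison[OF gen _ _ h h0 _ \<tau>(1) \<open>0 < e / 2\<close>]) (auto simp: g_def)
      then show "\<forall>\<^sub>F n in sequentially. dist (k n r) 0 < e"
      proof eventually_elim
        case (elim n)
        then have "(S r (S (h n) g) x - S r (T (h n) g) x) / h n \<le> e / 2"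
          using h[of n] by (simp add: g_def pos_divide_le_eq mult.commute)
        also have "e / 2 < e"
          using \<open>0 < e\<close> by simp
        finally show ?case
          using that \<open>0 < e\<close> by (simp add: k_def)
      qed
    qed
  qed
  then have "\<forall>\<^sub>F n in sequentially. integral {0..t} (k n) < \<epsilon>"
    using \<epsilon> by (intro order_tendstoD(2)) auto
  then obtain n where n: "integral {0..t} (k n) < \<epsilon>"
    unfolding eventually_sequentially by blast
  let ?h = "h n"
  let ?W = "{t - (\<tau> + ?h) - \<eta>..t - (\<tau> + ?h)}"
  have W: "?W \<subseteq> {0..t}"
    using h_le[of n] h[of n] d(3) \<tau> by auto
  have int1: "(\<lambda>r. S (max r 0) (S ?h g) x) integrable_on ?W"
    and int2: "(\<lambda>r. S (max r 0) (T ?h g) x) integrable_on ?W"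
    using h[of n] gC by (auto intro!: set_lebesgue_integral_eq_integral(1) S.integrable_time S.maps_to T.maps_to)
  have "window f x t \<eta> \<tau> = integral ?W (\<lambda>r. S (max (r + ?h) 0) g x)"
    using integral_shift_real_ivl[of "t - \<tau> - \<eta>" ?h "t - \<tau>" "\<lambda>r. S (max r 0) g x"]
    by (simp add: window_def g_def algebra_simps)
  also have "\<dots> = integral ?W (\<lambda>r. S (max r 0) (S ?h g) x)"
    using W h[of n] gC by (intro integral_cong) (auto simp: S.semigroup subset_iff)
  finally have 1: "window f x t \<eta> \<tau> = integral ?W (\<lambda>r. S (max r 0) (S ?h g) x)" .
  have "T (\<tau> + ?h) f = T ?h g"
    using T.semigroup[of ?h \<tau> f] fC h[of n] \<tau>(1) by (simp add: g_def add.commute)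
  then have 2: "window f x t \<eta> (\<tau> + ?h) = integral ?W (\<lambda>r. S (max r 0) (T ?h g) x)"
    by (simp add: window_def)
  have "window f x t \<eta> \<tau> - window f x t \<eta> (\<tau> + ?h)
      = integral ?W (\<lambda>r. S (max r 0) (S ?h g) x - S (max r 0) (T ?h g) x)"
    unfolding 1 2 using int1 int2 by (rule integral_diff[symmetric])
  also have "\<dots> \<le> integral ?W (\<lambda>r. ?h * k n r)"
  proof (rule integral_le)
    show "(\<lambda>r. S (max r 0) (S ?h g) x - S (max r 0) (T ?h g) x) integrable_on ?W"
      using int1 int2 by (rule integrable_diff)
    show "(\<lambda>r. ?h * k n r) integrable_on ?W"
      using integrable_on_subinterval[OF k_integrable W] by (intro integrable_on_mult_right) auto
    show "S (max r 0) (S ?h g) x - S (max r 0) (T ?h g) x \<le> ?h * k n r" for r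
    proof -
      have "(S (max r 0) (S ?h g) x - S (max r 0) (T ?h g) x) / ?h \<le> k n r"
        by (simp add: k_def)
      then show ?thesis
        using h[of n] by (simp add: pos_divide_le_eq mult.commute)
    qed
  qed
  also have "\<dots> = ?h * integral ?W (k n)"
    by simp
  also have "\<dots> \<le> ?h * integral {0..t} (k n)"
    using h[of n] integrable_on_subinterval[OF k_integrable W] W k_integrable
    by (intro mult_left_mono integral_subset_le) (auto simp: k_def)
  also have "\<dots> \<le> \<epsilon> * ?h"
    using n h[of n] by (simp add: mult.commute)
  finally show ?thesis
    using h[of n] h_le[of n] d(3) by (intro exI[of _ ?h]) auto
qed

text \<open>
  Passing from \<open>\<sigma>\<close> to \<open>\<tau> = \<sigma> + h\<close> changes the integrand by \<open>O(h)\<close> because \<open>f\<close> is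
  Lipschitz for \<open>T\<close>, and the interval by two pieces of length \<open>h\<close>.
\<close>

lemma window_left:
  assumes f: "f \<in> D" and \<tau>: "0 < \<tau>" "\<tau> \<le> t - \<eta>" "0 < \<eta>" and \<epsilon>: "0 < \<epsilon>"
  shows "\<exists>\<delta>>0. \<forall>\<sigma>. 0 \<le> \<sigma> \<and> \<tau> - \<delta> < \<sigma> \<and> \<sigma> < \<tau> \<longrightarrow> window f x t \<eta> \<sigma> \<le> window f x t \<eta> \<tau> + \<epsilon>"
proof -
  have t: "0 \<le> t"
    using \<tau> by simp
  have fC: "f \<in> C_kappa \<kappa>"
    using f by (rule D_C_kappa)
  have T: "T s f \<in> C_kappa \<kappa>" if "0 \<le> s" for s
    using that fC by (rule T.maps_to)
  obtain c \<delta> where c: "0 \<le> c" "0 < \<delta>"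
    "\<And>r s h x. \<lbrakk>0 \<le> r; r \<le> t; 0 \<le> s; 0 < h; h < \<delta>; s + h \<le> t\<rbrakk> \<Longrightarrow>
      S r (T s f) x \<le> S r (T (s + h) f) x + c * h / \<kappa> x"
    using mixed_lipschitz[OF f t] by blast
  obtain M where M: "0 \<le> M" "\<And>r x. 0 \<le> r \<Longrightarrow> r \<le> t \<Longrightarrow> \<bar>S r (T \<tau> f) x\<bar> \<le> M / \<kappa> x"
    using S.locally_bounded_orbit[OF T t, of \<tau>] \<tau> by auto
  define K where "K = c * \<eta> / \<kappa> x + 2 * (M / \<kappa> x)"
  have K: "0 \<le> K"
    using c(1) M(1) \<tau>(3) weight_pos[of x] by (simp add: K_def)
  show ?thesis
  proof (intro exI[of _ "min \<delta> (\<epsilon> / (K + 1))"] conjI allI impI)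
    show "0 < min \<delta> (\<epsilon> / (K + 1))"
      using c(2) \<epsilon> K by simp
    fix \<sigma> assume \<sigma>: "0 \<le> \<sigma> \<and> \<tau> - min \<delta> (\<epsilon> / (K + 1)) < \<sigma> \<and> \<sigma> < \<tau>"
    define h where "h = \<tau> - \<sigma>"
    have h: "0 < h" "h < \<delta>" "h < \<epsilon> / (K + 1)" "\<sigma> + h = \<tau>"
      using \<sigma> by (auto simp: h_def)
    define \<phi> where "\<phi> r = S (max r 0) (T \<tau> f) x" for r
    have \<phi>: "\<phi> integrable_on {u..v}" for u v
      unfolding \<phi>_def using T \<tau>(1) by (intro set_lebesgue_integral_eq_integral(1) S.integrable_time) auto
    have \<phi>_bound: "\<bar>\<phi> r\<bar> \<le> M / \<kappa> x" if "r \<le> t" for r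
      using M(2)[of "max r 0"] that t by (auto simp: \<phi>_def)
    let ?a = "t - \<tau> - \<eta>" let ?b = "t - \<tau>"
    have "window f x t \<eta> \<sigma> \<le> integral {?a + h..?b + h} (\<lambda>r. \<phi> r + c * h / \<kappa> x)"
    proof -
      have "{t - \<sigma> - \<eta>..t - \<sigma>} = {?a + h..?b + h}"
        by (simp add: h_def)
      then have "window f x t \<eta> \<sigma> = integral {?a + h..?b + h} (\<lambda>r. S (max r 0) (T \<sigma> f) x)"
        by (simp only: window_def)
      also have "\<dots> \<le> integral {?a + h..?b + h} (\<lambda>r. \<phi> r + c * h / \<kappa> x)"
      proof (rule integral_le)
        show "(\<lambda>r. S (max r 0) (T \<sigma> f) x) integrable_on {?a + h..?b + h}"
          using T \<sigma> by (intro set_lebesgue_integral_eq_integral(1) S.integrable_time) auto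
        show "(\<lambda>r. \<phi> r + c * h / \<kappa> x) integrable_on {?a + h..?b + h}"
          by (intro integrable_add \<phi> integrable_const_ivl)
        show "S (max r 0) (T \<sigma> f) x \<le> \<phi> r + c * h / \<kappa> x" if "r \<in> {?a + h..?b + h}" for r
          using c(3)[of "max r 0" \<sigma> h x] that \<sigma> h \<tau> t by (auto simp: \<phi>_def)
      qed
      finally show ?thesis .
    qed
    also have "\<dots> = integral {?a + h..?b + h} \<phi> + \<eta> * (c * h / \<kappa> x)"
      using \<tau>(3) by (subst integral_add[OF \<phi> integrable_const_ivl]) simp
    also have "integral {?a + h..?b + h} \<phi>
        = integral {?a..?b} \<phi> + integral {?b..?b + h} \<phi> - integral {?a..?a + h} \<phi>"
    proof -
      have "integral {?a..?a + h} \<phi> + integral {?a + h..?b + h} \<phi> = integral {?a..?b + h} \<phi>"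
        using h(1) \<tau>(3) by (intro Henstock_Kurzweil_Integration.integral_combine \<phi>) auto
      moreover have "integral {?a..?b} \<phi> + integral {?b..?b + h} \<phi> = integral {?a..?b + h} \<phi>"
        using h(1) \<tau>(3) by (intro Henstock_Kurzweil_Integration.integral_combine \<phi>) auto
      ultimately show ?thesis by simp
    qed
    also have "\<dots> \<le> integral {?a..?b} \<phi> + h * (M / \<kappa> x) + h * (M / \<kappa> x)"
    proof -
      have "integral {?b..?b + h} \<phi> \<le> integral {?b..?b + h} (\<lambda>r. M / \<kappa> x)"
      proof (rule integral_le[OF \<phi> integrable_const_ivl])
        show "\<phi> r \<le> M / \<kappa> x" if "r \<in> {?b..?b + h}" for r
          using \<phi>_bound[of r] that h(4) \<sigma> by auto
      qed
      also have "\<dots> = h * (M / \<kappa> x)"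
        using h(1) by simp
      finally have "integral {?b..?b + h} \<phi> \<le> h * (M / \<kappa> x)" .
      moreover have "- (h * (M / \<kappa> x)) = integral {?a..?a + h} (\<lambda>r. - (M / \<kappa> x))"
        using h(1) by simp
      moreover have "integral {?a..?a + h} (\<lambda>r. - (M / \<kappa> x)) \<le> integral {?a..?a + h} \<phi>"
      proof (rule integral_le[OF integrable_const_ivl \<phi>])
        show "- (M / \<kappa> x) \<le> \<phi> r" if "r \<in> {?a..?a + h}" for r
          using \<phi>_bound[of r] that h(4) \<sigma> \<tau>(3) by auto
      qed
      ultimately show ?thesis
        by linarith
    qed
    also have "integral {?a..?b} \<phi> = window f x t \<eta> \<tau>"
      by (simp add: window_def \<phi>_def[abs_def])
    finally have "window f x t \<eta> \<sigma> \<le> window f x t \<eta> \<tau> + K * h"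
      by (simp add: K_def algebra_simps)
    also have "K * h \<le> \<epsilon>"
    proof -
      have "h * (K + 1) \<le> \<epsilon>"
        using h(3) K by (simp add: field_simps)
      then show ?thesis
        using h(1) by (simp add: algebra_simps)
    qed
    finally show "window f x t \<eta> \<sigma> \<le> window f x t \<eta> \<tau> + \<epsilon>"
      by simp
  qed
qed

text \<open>
  The windows at \<open>\<tau> = 0\<close> and \<open>\<tau> = t - \<eta>\<close> average \<open>S r f x\<close> over \<open>r \<in> [t - \<eta>, t]\<close> and
  \<open>S r (T (t - \<eta>) f) x\<close> over \<open>r \<in> [0, \<eta>]\<close>.  As \<open>\<eta> \<down> 0\<close>, the first is asymptotically at
  least \<open>S t f x\<close>, as \<open>f\<close> is upper Lipschitz for \<open>S\<close>, and the second at most \<open>T t f x\<close>, by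
  upper semicontinuity of \<open>r \<mapsto> S r (T t f) x\<close> at \<open>0\<close> and Lipschitz continuity of the orbit of \<open>f\<close>.
\<close>

lemma le_on_generator_domain:
  assumes f: "f \<in> D" and gen: "(f, b) \<in> generator \<kappa> T" and "0 \<le> t"
  shows "S t f x \<le> T t f x"
proof (cases "t = 0")
  case True
  then show ?thesis
    using f by (simp add: D_C_kappa S.at_0 T.at_0)
next
  case False
  with \<open>0 \<le> t\<close> have t: "0 < t" by simp
  have fC: "f \<in> C_kappa \<kappa>"
    using f by (rule D_C_kappa)
  have T: "T s f \<in> C_kappa \<kappa>" if "0 \<le> s" for s
    using that fC by (rule T.maps_to)
  obtain c1 \<delta>1 where c1: "0 \<le> c1" "0 < \<delta>1"
    "\<And>r s h x. \<lbrakk>0 \<le> r; r \<le> t; 0 \<le> s; 0 < h; h < \<delta>1; s + h \<le> t\<rbrakk> \<Longrightarrow>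
      S r (T s f) x \<le> S r (T (s + h) f) x + c1 * h / \<kappa> x"
    using mixed_lipschitz[OF f \<open>0 \<le> t\<close>] by blast
  have "f \<in> upper_lipschitz_set \<kappa> S"
    using f D_subset by blast
  then obtain c2 \<delta>2 where c2: "0 \<le> c2" "0 < \<delta>2"
    "\<And>r h x. \<lbrakk>0 \<le> r; r \<le> t; 0 < h; h < \<delta>2\<rbrakk> \<Longrightarrow> S (r + h) f x \<le> S r f x + c2 * h / \<kappa> x"
    using S.upper_lipschitz_time[OF _ \<open>0 \<le> t\<close>] by blast
  show ?thesis
  proof (rule field_le_epsilon)
    fix \<epsilon> :: real assume "0 < \<epsilon>"
    then have "0 < \<epsilon> / 2" by simp
    then obtain \<delta>3 where \<delta>3: "0 < \<delta>3" "\<And>r. 0 \<le> r \<Longrightarrow> r < \<delta>3 \<Longrightarrow> S r (T t f) x \<le> T t f x + \<epsilon> / 2"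
      using S.upper_semicontinuous_at_0[OF T[OF \<open>0 \<le> t\<close>]] by blast
    define K where "K = c1 / \<kappa> x + c2 / \<kappa> x + 1"
    have "0 \<le> c1 / \<kappa> x" "0 \<le> c2 / \<kappa> x"
      using c1(1) c2(1) weight_pos[of x] by simp_all
    then have K: "0 < K"
      by (simp add: K_def)
    \<comment> \<open>The window is so short that all errors together are at most \<open>\<epsilon>\<close>.\<close>
    define \<delta> where "\<delta> = min \<delta>1 (min \<delta>2 \<delta>3)"
    have \<delta>: "0 < \<delta>" "\<delta> \<le> \<delta>1" "\<delta> \<le> \<delta>2" "\<delta> \<le> \<delta>3"
      using c1(2) c2(2) \<delta>3(1) by (auto simp: \<delta>_def)
    define \<eta> where "\<eta> = min (min t (\<epsilon> / 2 / K)) (\<delta> / 2)"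
    have "\<eta> \<le> \<delta> / 2"
      unfolding \<eta>_def by (rule min.cobounded2)
    moreover have "0 < \<eta>" "\<eta> \<le> t"
      using t \<open>0 < \<epsilon>\<close> K \<delta>(1) by (auto simp: \<eta>_def)
    ultimately have \<eta>: "0 < \<eta>" "\<eta> \<le> t" "\<eta> < \<delta>1" "\<eta> < \<delta>2" "\<eta> < \<delta>3"
      using \<delta> by linarith+
    have "\<eta> \<le> \<epsilon> / 2 / K"
      by (simp add: \<eta>_def)
    then have \<eta>K: "K * \<eta> \<le> \<epsilon> / 2"
      using K by (simp add: pos_le_divide_eq mult_ac)
    have "\<eta> * (S t f x - c2 * \<eta> / \<kappa> x) = integral {t - \<eta>..t} (\<lambda>r. S t f x - c2 * \<eta> / \<kappa> x)"
      using \<eta>(1) by simp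
    also have "\<dots> \<le> window f x t \<eta> 0"
    proof -
      have "integral {t - \<eta>..t} (\<lambda>r. S t f x - c2 * \<eta> / \<kappa> x) \<le> integral {t - \<eta>..t} (\<lambda>r. S (max r 0) f x)"
      proof (rule integral_le)
        show "(\<lambda>r. S (max r 0) f x) integrable_on {t - \<eta>..t}"
          using fC by (intro set_lebesgue_integral_eq_integral(1) S.integrable_time)
        show "S t f x - c2 * \<eta> / \<kappa> x \<le> S (max r 0) f x" if "r \<in> {t - \<eta>..t}" for r
        proof (cases "r = t")
          case True
          then show ?thesis
            using t c2(1) \<eta>(1) weight_pos[of x] by simp
        next
          case False
          have "S (r + (t - r)) f x \<le> S r f x + c2 * (t - r) / \<kappa> x"
            using that False \<eta> by (intro c2(3)) auto
          moreover have "c2 * (t - r) / \<kappa> x \<le> c2 * \<eta> / \<kappa> x"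
            using that c2(1) weight_pos[of x] by (intro divide_right_mono mult_left_mono) auto
          ultimately show ?thesis
            using that \<eta>(2) by simp
        qed
      qed (rule integrable_const_ivl)
      then show ?thesis
        using fC by (simp add: window_def T.at_0)
    qed
    also have "\<dots> \<le> window f x t \<eta> (t - \<eta>)"
    proof (rule le_of_right_increase)
      show "0 \<le> t - \<eta>"
        using \<eta>(2) by simp
    qed (intro window_right[OF f gen] window_left[OF f] \<eta>(1); assumption)+
    also have "\<dots> \<le> integral {0..\<eta>} (\<lambda>r. T t f x + \<epsilon> / 2 + c1 * \<eta> / \<kappa> x)"
    proof -
      have "integral {0..\<eta>} (\<lambda>r. S (max r 0) (T (t - \<eta>) f) x)
          \<le> integral {0..\<eta>} (\<lambda>r. T t f x + \<epsilon> / 2 + c1 * \<eta> / \<kappa> x)"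
      proof (rule integral_le)
        show "(\<lambda>r. S (max r 0) (T (t - \<eta>) f) x) integrable_on {0..\<eta>}"
          using T \<eta>(2) by (intro set_lebesgue_integral_eq_integral(1) S.integrable_time) auto
        show "S (max r 0) (T (t - \<eta>) f) x \<le> T t f x + \<epsilon> / 2 + c1 * \<eta> / \<kappa> x" if "r \<in> {0..\<eta>}" for r
          using c1(3)[of r "t - \<eta>" \<eta> x] \<delta>3(2)[of r] that \<eta> by simp
      qed (rule integrable_const_ivl)
      then show ?thesis
        by (simp add: window_def)
    qed
    also have "\<dots> = \<eta> * (T t f x + \<epsilon> / 2 + c1 * \<eta> / \<kappa> x)"
      using \<eta>(1) by simp
    finally have "S t f x - c2 * \<eta> / \<kappa> x \<le> T t f x + \<epsilon> / 2 + c1 * \<eta> / \<kappa> x"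
      using \<eta>(1) by simp
    then have "S t f x \<le> T t f x + \<epsilon> / 2 + K * \<eta>"
      using \<eta>(1) by (simp add: K_def algebra_simps)
    with \<eta>K show "S t f x \<le> T t f x + \<epsilon>"
      by simp
  qed
qed

end

theorem theorem3p7:
  fixes \<kappa> :: "'a::polish_space \<Rightarrow> real"
    and S T :: "real \<Rightarrow> ('a \<Rightarrow> real) \<Rightarrow> ('a \<Rightarrow> real)"
    and D :: "('a \<Rightarrow> real) set"
  assumes "\<And>x. \<kappa> x > 0" and "bounded (range \<kappa>)" and "continuous_on UNIV \<kappa>"
    and "convex_monotone_semigroup \<kappa> S" and "convex_monotone_semigroup \<kappa> T"
    and "D \<subseteq> lipschitz_set \<kappa> T \<inter> upper_lipschitz_set \<kappa> S"
    and "\<And>t f. t \<ge> 0 \<Longrightarrow> f \<in> D \<Longrightarrow> T t f \<in> D"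
    and "\<And>f. f \<in> D \<Longrightarrow> upper_Gamma_generator S f \<le> upper_Gamma_generator T f"
  shows "\<forall>t\<ge>0. \<forall>f \<in> D \<inter> Domain (generator \<kappa> T). S t f \<le> T t f"
proof -
  interpret weight \<kappa>
    using assms(1,3) by unfold_locales
  interpret S: convex_monotone_semigroup \<kappa> S by fact
  interpret T: convex_monotone_semigroup \<kappa> T by fact
  interpret semigroup_comparison \<kappa> S T D
    using assms(6-8) by unfold_locales
  show ?thesis
    using le_on_generator_domain by (auto simp: le_fun_def Domain_iff)
qed

end
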